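(* Let $\mathcal{X}$ and $\mathcal{Y}$ be complex Banach spaces. The following are equivalent: (1) $\mathcal{X}$ and $\mathcal{Y}$ are essentially incomparable; (2) whenever $U\in\mathcal{B}(\mathcal{X})$ and $V\in\mathcal{B}(\mathcal{Y})$ are Schur coupled (SC), both $U$ and $V$ are Fredholm with index $0$; (2') whenever $U\in\mathcal{B}(\mathcal{X})$ and $V\in\mathcal{B}(\mathcal{Y})$ are Schur coupled (SC), both $U$ and $V$ are Fredholm; (3) whenever $U\in\mathcal{B}(\mathcal{X})$ and $V\in\mathcal{B}(\mathcal{Y})$ are equivalent after extension (EAE), both $U$ and $V$ are Fredholm.
   Context: All Banach spaces are complex. $\mathcal{B}(\mathcal{V},\mathcal{W})$ is the space of bounded linear operators from $\mathcal{V}$ to $\mathcal{W}$, and $\mathcal{B}(\mathcal{V})=\mathcal{B}(\mathcal{V},\mathcal{V})$. "Operator" means bounded linear operator; "invertible" means with bounded inverse. Equivalent after extension (EAE): $U\in\mathcal{B}(\mathcal{X})$ and $V\in\mathcal{B}(\mathcal{Y})$ are EAE if there exist Banach spaces $\mathcal{X}_0,\mathcal{Y}_0$ and invertible operators $E\in\mathcal{B}(\mathcal{Y}\oplus\mathcal{Y}_0,\mathcal{X}\oplus\mathcal{X}_0)$ and $F\in\mathcal{B}(\mathcal{X}\oplus\mathcal{X}_0,\mathcal{Y}\oplus\mathcal{Y}_0)$ with $U\oplus I_{\mathcal{X}_0}=E\,(V\oplus I_{\mathcal{Y}_0})\,F$. Schur coupled (SC): there exists a block operator $\begin{bmatrix}A&B\\C&D\end{bmatrix}\in\mathcal{B}(\mathcal{X}\oplus\mathcal{Y})$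 with $A\in\mathcal{B}(\mathcal{X})$ and $D\in\mathcal{B}(\mathcal{Y})$ invertible such that $U=A-BD^{-1}C$ and $V=D-CA^{-1}B$. An operator $S\in\mathcal{B}(\mathcal{X},\mathcal{Y})$ is inessential if $I_{\mathcal{X}}-TS$ is Fredholm for every $T\in\mathcal{B}(\mathcal{Y},\mathcal{X})$. The Banach spaces $\mathcal{X}$ and $\mathcal{Y}$ are essentially incomparable if every operator in $\mathcal{B}(\mathcal{X},\mathcal{Y})$ is inessential. *)

theory Defs
  imports "HOL-Analysis.Analysis"
begin

section \<open>Complex Banach spaces\<close>

class complex_normed_vector = real_normed_vector +
  fixes scaleC :: "complex \<Rightarrow> 'a \<Rightarrow> 'a" (infixr \<open>*\<^sub>C\<close> 75)
  assumes scaleC_add_right: "c *\<^sub>C (x + y) = c *\<^sub>C x + c *\<^sub>C y"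
    and scaleC_add_left: "(c + d) *\<^sub>C x = c *\<^sub>C x + d *\<^sub>C x"
    and scaleC_scaleC: "c *\<^sub>C d *\<^sub>C x = (c * d) *\<^sub>C x"
    and scaleC_of_real: "complex_of_real r *\<^sub>C x = r *\<^sub>R x"
    and norm_scaleC: "norm (c *\<^sub>C x) = cmod c * norm x"

class complex_banach = complex_normed_vector + complete_space

subclass (in complex_banach) banach ..

lemma scaleC_one: "1 *\<^sub>C x = (x :: 'a :: complex_normed_vector)"
  using scaleC_of_real[of 1 x] by simp

global_interpretation complex_vector:
  vector_space "scaleC :: complex \<Rightarrow> 'a \<Rightarrow> 'a :: complex_normed_vector"
  by unfold_locales
    (simp_all add: scaleC_add_right scaleC_add_left scaleC_scaleC scaleC_one)

instantiation complex :: complex_banach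
begin

definition scaleC_complex :: "complex \<Rightarrow> complex \<Rightarrow> complex" where
  "scaleC_complex c x = c * x"

instance
  by standard (simp_all add: scaleC_complex_def algebra_simps norm_mult scaleR_conv_of_real)

end

text \<open>
  The direct sum of two Banach spaces is the product type. It carries the Euclidean
  combination of the two norms, which is equivalent to any other usual choice.
\<close>

instantiation prod :: (complex_normed_vector, complex_normed_vector) complex_normed_vector
begin

definition scaleC_prod :: "complex \<Rightarrow> 'a \<times> 'b \<Rightarrow> 'a \<times> 'b" where
  "scaleC_prod c z = (c *\<^sub>C fst z, c *\<^sub>C snd z)"

instance
proof
  fix c :: complex and z :: "'a \<times> 'b"
  have "norm (c *\<^sub>C z) = sqrt ((cmod c)\<^sup>2 * ((norm (fst z))\<^sup>2 + (norm (snd z))\<^sup>2))"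
    by (simp add: scaleC_prod_def norm_prod_def norm_scaleC power_mult_distrib distrib_left)
  then show "norm (c *\<^sub>C z) = cmod c * norm z"
    by (simp add: norm_prod_def real_sqrt_mult)
qed (simp_all add: scaleC_prod_def prod_eq_iff scaleC_add_right scaleC_add_left
       scaleC_scaleC scaleC_of_real)

end

instance prod :: (complex_banach, complex_banach) complex_banach ..


section \<open>Bounded operators\<close>

definition bounded_clinear ::
  "('a :: complex_normed_vector \<Rightarrow> 'b :: complex_normed_vector) \<Rightarrow> bool" where
  "bounded_clinear f \<longleftrightarrow> bounded_linear f \<and> (\<forall>c x. f (c *\<^sub>C x) = c *\<^sub>C f x)"

definition invertible_op ::
  "('a :: complex_normed_vector \<Rightarrow> 'b :: complex_normed_vector) \<Rightarrow> bool" where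
  "invertible_op f \<longleftrightarrow>
     bounded_clinear f \<and> (\<exists>g. bounded_clinear g \<and> g \<circ> f = id \<and> f \<circ> g = id)"

text \<open>Operators between subspaces \<open>S\<close> and \<open>T\<close>; values outside \<open>S\<close> are irrelevant.\<close>

definition bounded_clinear_on ::
  "'a :: complex_normed_vector set \<Rightarrow> 'b :: complex_normed_vector set \<Rightarrow> ('a \<Rightarrow> 'b) \<Rightarrow> bool" where
  "bounded_clinear_on S T f \<longleftrightarrow>
     f ` S \<subseteq> T \<and>
     (\<forall>x\<in>S. \<forall>y\<in>S. f (x + y) = f x + f y) \<and>
     (\<forall>c. \<forall>x\<in>S. f (c *\<^sub>C x) = c *\<^sub>C f x) \<and>
     (\<exists>K. \<forall>x\<in>S. norm (f x) \<le> K * norm x)"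

definition invertible_op_on ::
  "'a :: complex_normed_vector set \<Rightarrow> 'b :: complex_normed_vector set \<Rightarrow> ('a \<Rightarrow> 'b) \<Rightarrow> bool" where
  "invertible_op_on S T f \<longleftrightarrow>
     bounded_clinear_on S T f \<and>
     (\<exists>g. bounded_clinear_on T S g \<and> (\<forall>x\<in>S. g (f x) = x) \<and> (\<forall>y\<in>T. f (g y) = y))"

lemma bounded_clinear_on_UNIV: "bounded_clinear_on UNIV UNIV f \<longleftrightarrow> bounded_clinear f"
proof
  assume "bounded_clinear_on UNIV UNIV f"
  then obtain K where f: "\<And>x y. f (x + y) = f x + f y" "\<And>c x. f (c *\<^sub>C x) = c *\<^sub>C f x"
    "\<And>x. norm (f x) \<le> K * norm x"
    by (auto simp: bounded_clinear_on_def)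
  have "f (r *\<^sub>R x) = r *\<^sub>R f x" for r x
    using f(2)[of "complex_of_real r" x] by (simp add: scaleC_of_real)
  then have "bounded_linear f"
    using f by (intro bounded_linear_intro[where K = K]) (simp_all add: mult.commute)
  then show "bounded_clinear f"
    using f by (simp add: bounded_clinear_def)
next
  assume "bounded_clinear f"
  then have f: "bounded_linear f" "\<And>c x. f (c *\<^sub>C x) = c *\<^sub>C f x"
    by (auto simp: bounded_clinear_def)
  from bounded_linear.bounded[OF f(1)] have "\<exists>K. \<forall>x. norm (f x) \<le> K * norm x"
    by (simp add: mult.commute)
  then show "bounded_clinear_on UNIV UNIV f"
    using f by (simp add: bounded_clinear_on_def bounded_linear.linear linear_add)
qed

lemma invertible_op_on_UNIV: "invertible_op_on UNIV UNIV f \<longleftrightarrow> invertible_op f"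
  by (simp add: invertible_op_on_def invertible_op_def bounded_clinear_on_UNIV fun_eq_iff)


section \<open>Fredholm operators, inessential operators\<close>

definition kernel :: "('a \<Rightarrow> 'b :: zero) \<Rightarrow> 'a set" where
  "kernel f = {x. f x = 0}"

definition finite_cdim :: "'a :: complex_normed_vector set \<Rightarrow> bool" where
  "finite_cdim S \<longleftrightarrow> (\<exists>B. finite B \<and> complex_vector.span B = S)"

text \<open>
  For a subspace \<open>R\<close>, the cosets of the elements of \<open>B\<close> span the quotient by \<open>R\<close> iff
  \<open>R \<union> B\<close> spans the whole space, and the dimension of the quotient is the least number
  of elements of such a \<open>B\<close>. The range of a Fredholm operator between Banach spaces is
  automatically closed, so closedness is not part of the definition.
\<close>

definition finite_ccodim :: "'a :: complex_normed_vector set \<Rightarrow> bool" where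
  "finite_ccodim R \<longleftrightarrow> (\<exists>B. finite B \<and> complex_vector.span (R \<union> B) = UNIV)"

definition ccodim :: "'a :: complex_normed_vector set \<Rightarrow> nat" where
  "ccodim R = (LEAST n. \<exists>B. finite B \<and> card B = n \<and> complex_vector.span (R \<union> B) = UNIV)"

definition fredholm :: "('a :: complex_banach \<Rightarrow> 'b :: complex_banach) \<Rightarrow> bool" where
  "fredholm f \<longleftrightarrow> bounded_clinear f \<and> finite_cdim (kernel f) \<and> finite_ccodim (range f)"

definition fredholm_index :: "('a :: complex_banach \<Rightarrow> 'b :: complex_banach) \<Rightarrow> int" where
  "fredholm_index f = int (complex_vector.dim (kernel f)) - int (ccodim (range f))"

definition inessential :: "('a :: complex_banach \<Rightarrow> 'b :: complex_banach) \<Rightarrow> bool" where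
  "inessential S \<longleftrightarrow>
     bounded_clinear S \<and>
     (\<forall>T :: 'b \<Rightarrow> 'a. bounded_clinear T \<longrightarrow> fredholm (\<lambda>x. x - T (S x)))"

definition essentially_incomparable ::
  "'a :: complex_banach itself \<Rightarrow> 'b :: complex_banach itself \<Rightarrow> bool" where
  "essentially_incomparable _ _ \<longleftrightarrow> (\<forall>S :: 'a \<Rightarrow> 'b. bounded_clinear S \<longrightarrow> inessential S)"


section \<open>Schur coupling and equivalence after extension\<close>

definition block_op ::
  "('a \<Rightarrow> 'a) \<Rightarrow> ('b \<Rightarrow> 'a) \<Rightarrow> ('a \<Rightarrow> 'b) \<Rightarrow> ('b \<Rightarrow> 'b) \<Rightarrow>
   'a :: plus \<times> 'b :: plus \<Rightarrow> 'a \<times> 'b" where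
  "block_op A B C D = (\<lambda>(x, y). (A x + B y, C x + D y))"

definition schur_coupled ::
  "('a :: complex_banach \<Rightarrow> 'a) \<Rightarrow> ('b :: complex_banach \<Rightarrow> 'b) \<Rightarrow> bool" where
  "schur_coupled U V \<longleftrightarrow>
     (\<exists>A B C D. bounded_clinear A \<and> bounded_clinear B \<and> bounded_clinear C \<and> bounded_clinear D \<and>
        bounded_clinear (block_op A B C D) \<and>
        invertible_op A \<and> invertible_op D \<and>
        U = (\<lambda>x. A x - B (inv D (C x))) \<and>
        V = (\<lambda>y. D y - C (inv A (B y))))"

definition closed_csubspace :: "'a :: complex_normed_vector set \<Rightarrow> bool" where
  "closed_csubspace S \<longleftrightarrow> closed S \<and> complex_vector.subspace S"

text \<open>
  HOL cannot quantify over types inside a formula, so the Banach spaces \<open>X0\<close> and \<open>Y0\<close>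
  range over the closed subspaces of an ambient Banach space \<open>'w\<close>, which is a parameter
  of the definition. Equivalence after extension without a bound on the extension spaces
  means \<open>equivalent_after_extension TYPE('w) U V\<close> for some \<open>'w\<close>: any two Banach spaces
  embed as closed subspaces into their direct sum, see
  \<open>equivalent_after_extension_types\<close> below.
\<close>

definition equivalent_after_extension ::
  "'w :: complex_banach itself \<Rightarrow> ('a :: complex_banach \<Rightarrow> 'a) \<Rightarrow>
   ('b :: complex_banach \<Rightarrow> 'b) \<Rightarrow> bool" where
  "equivalent_after_extension _ U V \<longleftrightarrow>
     (\<exists>(X0 :: 'w set) (Y0 :: 'w set) E F.
        closed_csubspace X0 \<and> closed_csubspace Y0 \<and>
        invertible_op_on (UNIV \<times> Y0) (UNIV \<times> X0) E \<and>
        invertible_op_on (UNIV \<times> X0) (UNIV \<times> Y0) F \<and>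
        (\<forall>z \<in> UNIV \<times> X0. map_prod U id z = E (map_prod V id (F z))))"

lemma closed_csubspace_range_isometry:
  fixes i :: "'c :: complex_banach \<Rightarrow> 'w :: complex_banach"
  assumes i: "bounded_clinear i" "\<And>x. norm (i x) = norm x"
  shows "closed_csubspace (range i)"
proof -
  have lin: "bounded_linear i" and sc: "\<And>c x. i (c *\<^sub>C x) = c *\<^sub>C i x"
    using i(1) by (auto simp: bounded_clinear_def)
  have "complete (range i)"
    by (rule complete_isometric_image[where e = 1, OF _ subspace_UNIV lin])
      (use i(2) in \<open>auto simp: complete_UNIV\<close>)
  then have "closed (range i)"
    by (rule complete_imp_closed)
  moreover have "complex_vector.subspace (range i)"
  proof (rule complex_vector.subspaceI)
    show "0 \<in> range i"
      by (rule range_eqI[where x = 0]) (simp add: linear_0[OF bounded_linear.linear[OF lin]])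
    show "x + y \<in> range i" if "x \<in> range i" "y \<in> range i" for x y
      using that by (auto simp flip: linear_add[OF bounded_linear.linear[OF lin]])
    show "c *\<^sub>C x \<in> range i" if "x \<in> range i" for c x
      using that by (auto simp flip: sc)
  qed
  ultimately show ?thesis
    by (simp add: closed_csubspace_def)
qed

lemma bounded_clinear_on_transport:
  fixes i :: "'c :: complex_banach \<Rightarrow> 'w :: complex_banach"
    and j :: "'d :: complex_banach \<Rightarrow> 'w"
    and G :: "'a :: complex_banach \<times> 'c \<Rightarrow> 'b :: complex_banach \<times> 'd"
  assumes i: "bounded_clinear i" "\<And>x. norm (i x) = norm x"
    and j: "bounded_clinear j" "\<And>x. norm (j x) = norm x"
    and G: "bounded_clinear G"
  shows "bounded_clinear_on (UNIV \<times> range i) (UNIV \<times> range j)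
           (map_prod id j \<circ> G \<circ> map_prod id (inv i))"
proof -
  have i': "\<And>x y. i x + i y = i (x + y)" "\<And>c x. c *\<^sub>C i x = i (c *\<^sub>C x)"
    and j': "\<And>x y. j (x + y) = j x + j y" "\<And>c x. j (c *\<^sub>C x) = c *\<^sub>C j x"
    and G': "\<And>x y. G (x + y) = G x + G y" "\<And>c x. G (c *\<^sub>C x) = c *\<^sub>C G x"
    using i(1) j(1) G by (simp_all only: bounded_clinear_def bounded_linear.linear linear_add)
  have "linear i"
    using i(1) by (simp add: bounded_clinear_def bounded_linear.linear)
  then have "inj i"
    using i(2) by (simp add: linear_injective_0) (metis norm_eq_zero)
  then have inv: "inv i (i x) = x" for x
    by simp
  obtain K where K: "\<And>z. norm (G z) \<le> K * norm z"
    using G bounded_linear.bounded by (metis bounded_clinear_def mult.commute)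
  have nj: "norm (map_prod id j p) = norm p" for p :: "'b \<times> 'd"
    by (simp add: norm_prod_def j(2))
  have ni: "norm (x, i c) = norm (x, c)" for x :: 'a and c
    by (simp add: norm_prod_def i(2))
  have jadd: "map_prod id j (p + q) = map_prod id j p + map_prod id j q" for p q :: "'b \<times> 'd"
    by (simp add: prod_eq_iff j')
  have jsc: "map_prod id j (c *\<^sub>C p) = c *\<^sub>C map_prod id j p" for c and p :: "'b \<times> 'd"
    by (simp add: prod_eq_iff j' scaleC_prod_def)
  have pairsc: "(c *\<^sub>C x, c *\<^sub>C y) = c *\<^sub>C (x, y)" for c and x :: 'a and y :: 'c
    by (simp add: scaleC_prod_def)
  have "norm ((map_prod id j \<circ> G \<circ> map_prod id (inv i)) z) \<le> K * norm z"
    if "z \<in> UNIV \<times> range i" for z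
    using that K by (auto simp: nj ni inv)
  moreover have "(map_prod id j \<circ> G \<circ> map_prod id (inv i)) ` (UNIV \<times> range i) \<subseteq> UNIV \<times> range j"
    by (auto simp: map_prod_def split: prod.splits)
  moreover have "(map_prod id j \<circ> G \<circ> map_prod id (inv i)) (x + y) =
      (map_prod id j \<circ> G \<circ> map_prod id (inv i)) x + (map_prod id j \<circ> G \<circ> map_prod id (inv i)) y"
    if "x \<in> UNIV \<times> range i" "y \<in> UNIV \<times> range i" for x y
    using that by (auto simp: i' inv simp flip: jadd G')
  moreover have "(map_prod id j \<circ> G \<circ> map_prod id (inv i)) (c *\<^sub>C x) =
      c *\<^sub>C (map_prod id j \<circ> G \<circ> map_prod id (inv i)) x"
    if "x \<in> UNIV \<times> range i" for c x
    using that by (auto simp: scaleC_prod_def[of c "(_, i _)"] i' inv pairsc G' jsc)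
  ultimately show ?thesis
    unfolding bounded_clinear_on_def by (intro conjI ballI allI exI[of _ K])
qed

lemma invertible_op_on_transport:
  fixes i :: "'c :: complex_banach \<Rightarrow> 'w :: complex_banach"
    and j :: "'d :: complex_banach \<Rightarrow> 'w"
    and G :: "'a :: complex_banach \<times> 'c \<Rightarrow> 'b :: complex_banach \<times> 'd"
  assumes i: "bounded_clinear i" "\<And>x. norm (i x) = norm x"
    and j: "bounded_clinear j" "\<And>x. norm (j x) = norm x"
    and G: "invertible_op G"
  shows "invertible_op_on (UNIV \<times> range i) (UNIV \<times> range j)
           (map_prod id j \<circ> G \<circ> map_prod id (inv i))"
proof -
  obtain H where H: "bounded_clinear H" "\<And>z. H (G z) = z" "\<And>z. G (H z) = z"
    using G by (auto simp: invertible_op_def fun_eq_iff)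
  have "linear i" "linear j"
    using i(1) j(1) by (simp_all add: bounded_clinear_def bounded_linear.linear)
  then have "inj i" "inj j"
    using i(2) j(2) by (simp_all add: linear_injective_0) (metis norm_eq_zero)+
  then have inv: "inv i (i x) = x" "inv j (j y) = y" for x y
    by simp_all
  have cancel: "map_prod id (inv i) (map_prod id i p) = p"
    "map_prod id (inv j) (map_prod id j q) = q" for p :: "'a \<times> 'c" and q :: "'b \<times> 'd"
    by (simp_all add: prod_eq_iff inv)
  show ?thesis
    unfolding invertible_op_on_def
    using bounded_clinear_on_transport[OF i j, of G] bounded_clinear_on_transport[OF j i H(1)] G
    by (intro conjI exI[of _ "map_prod id i \<circ> H \<circ> map_prod id (inv j)"])
      (auto simp: cancel H inv invertible_op_def)
qed

text \<open>The extension spaces may be arbitrary Banach space types \<open>'c\<close> and \<open>'d\<close>.\<close>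

lemma equivalent_after_extension_types:
  fixes U :: "'a :: complex_banach \<Rightarrow> 'a" and V :: "'b :: complex_banach \<Rightarrow> 'b"
    and E :: "'b \<times> 'd :: complex_banach \<Rightarrow> 'a \<times> 'c :: complex_banach"
    and F :: "'a \<times> 'c \<Rightarrow> 'b \<times> 'd"
  assumes E: "invertible_op E" and F: "invertible_op F"
    and eq: "map_prod U id = E \<circ> map_prod V id \<circ> F"
  shows "equivalent_after_extension TYPE('a \<times> 'b \<times> 'c \<times> 'd) U V"
proof -
  define i :: "'c \<Rightarrow> 'a \<times> 'b \<times> 'c \<times> 'd" where "i = (\<lambda>x. (0, 0, x, 0))"
  define j :: "'d \<Rightarrow> 'a \<times> 'b \<times> 'c \<times> 'd" where "j = (\<lambda>x. (0, 0, 0, x))"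
  have ni: "norm (i x) = norm x" and nj: "norm (j y) = norm y" for x y
    by (simp_all add: i_def j_def norm_prod_def)
  have bi: "bounded_clinear i"
    unfolding bounded_clinear_on_UNIV[symmetric] bounded_clinear_on_def
    by (auto simp: ni i_def scaleC_prod_def norm_prod_def intro!: exI[of _ 1])
  have bj: "bounded_clinear j"
    unfolding bounded_clinear_on_UNIV[symmetric] bounded_clinear_on_def
    by (auto simp: nj j_def scaleC_prod_def norm_prod_def intro!: exI[of _ 1])
  have inv: "inv i (i x) = x" "inv j (j y) = y" for x y
    by (rule inv_f_f, simp add: i_def j_def inj_def)+
  have comm: "map_prod V id (map_prod id (inv j) (map_prod id j q)) = map_prod V id q"
    "map_prod id (inv j) (map_prod V id (map_prod id j q)) = map_prod V id q" for q
    by (simp_all add: prod_eq_iff inv)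
  have "map_prod U id (x, i y) = map_prod id i (E (map_prod V id (F (x, y))))" for x y
    using arg_cong[OF fun_cong[OF eq, of "(x, y)"], of "map_prod id i"] by simp
  then have "\<forall>z \<in> UNIV \<times> range i. map_prod U id z =
      (map_prod id i \<circ> E \<circ> map_prod id (inv j))
        (map_prod V id ((map_prod id j \<circ> F \<circ> map_prod id (inv i)) z))"
    by (auto simp: inv comm)
  then show ?thesis
    unfolding equivalent_after_extension_def
    using closed_csubspace_range_isometry[OF bi ni] closed_csubspace_range_isometry[OF bj nj]
      invertible_op_on_transport[OF bj nj bi ni E] invertible_op_on_transport[OF bi ni bj nj F]
    by (intro exI conjI)
qed

end

theory Submission
  imports Defs
begin

text \<open>
  The operators \<open>I - T S\<close> with \<open>S : X \<rightarrow> Y\<close>, \<open>T : Y \<rightarrow> X\<close> are both Schur coupled to and equivalent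
  after extension to \<open>I - S T\<close>, so each of the last three conditions forces them to be Fredholm.
  Conversely, Schur coupled operators are of the form \<open>A (I - T S)\<close> and \<open>D (I - S T)\<close> with \<open>A\<close>,
  \<open>D\<close> invertible, and an operator equivalent after extension to an operator on the other space
  is invertible from both sides modulo products through that space. The index of \<open>I - T S\<close>
  vanishes because \<open>I - t T S\<close> is Fredholm for \<open>0 \<le> t \<le> 1\<close> and being an invertible plus a
  finite-rank operator is an open and closed condition along this segment.
\<close>

section \<open>Bounded complex-linear operators\<close>

text \<open>Condition (3) cannot carry an index. The backward shifts on l2 and l3 are onto with
  one-dimensional kernel; extended by the identity of the other space they become two such operators
  on the same sum, hence equivalent, although l2 and l3 are essentially incomparable and both shifts
  have index 1. So index 0 must come from Schur coupling itself: replacing \<open>T\<close> by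
  \<open>c *\<^sub>C T\<close> stays among the operators from Y to X, and this joins I - T S to I
  through Fredholm operators.

  The analytic input for following the index along this path is a bounded left parametrix at each
  point. Hahn-Banach supplies it with bounded projections onto finite-dimensional subspaces, the
  open mapping theorem with norm control.

  In the last equivalence the ambient space \<open>'x \<times> 'y \<times> 'u\<close> contains
  copies of both spaces, which serve as each other's extension spaces for I - T S and I - S T; since
  \<open>'u\<close> is arbitrary, larger extension spaces are covered as well.\<close>

lemma bounded_clinearI:
  assumes "\<And>x y. f (x + y) = f x + f y" "\<And>c x. f (c *\<^sub>C x) = c *\<^sub>C f x"
    "\<And>x. norm (f x) \<le> K * norm x"
  shows "bounded_clinear f"
  using assms by (auto simp: bounded_clinear_on_UNIV[symmetric] bounded_clinear_on_def)

lemma bounded_clinear_bounded_linear: "bounded_clinear f \<Longrightarrow> bounded_linear f"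
  by (simp add: bounded_clinear_def)

lemma bounded_clinear_scaleC: "bounded_clinear f \<Longrightarrow> f (c *\<^sub>C x) = c *\<^sub>C f x"
  by (simp add: bounded_clinear_def)

lemma
  assumes "bounded_clinear f"
  shows bounded_clinear_add: "f (x + y) = f x + f y"
    and bounded_clinear_diff: "f (x - y) = f x - f y"
    and bounded_clinear_zero: "f 0 = 0"
  using bounded_linear.linear[OF bounded_clinear_bounded_linear[OF assms]]
  by (simp_all add: linear_add linear_diff linear_0)

lemma bounded_clinear_bound:
  assumes "bounded_clinear f"
  obtains K where "K > 0" "\<And>x. norm (f x) \<le> K * norm x"
  using bounded_linear.pos_bounded[OF bounded_clinear_bounded_linear[OF assms]]
  by (auto simp: mult.commute)

lemma bounded_clinear_linear:
  "bounded_clinear f \<Longrightarrow> Vector_Spaces.linear scaleC scaleC f"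
  by (auto simp: Vector_Spaces.linear_iff bounded_clinear_add bounded_clinear_scaleC
      complex_vector.vector_space_axioms)

global_interpretation complex_vector_pair:
  vector_space_pair "scaleC :: complex \<Rightarrow> 'a \<Rightarrow> 'a :: complex_normed_vector"
    "scaleC :: complex \<Rightarrow> 'b \<Rightarrow> 'b :: complex_normed_vector" ..

lemma bounded_clinear_id: "bounded_clinear (\<lambda>x. x)"
  by (simp add: bounded_clinear_def)

lemma bounded_clinear_const_zero: "bounded_clinear (\<lambda>x. 0)"
  by (simp add: bounded_clinear_def)

lemma bounded_clinear_compose:
  "bounded_clinear f \<Longrightarrow> bounded_clinear g \<Longrightarrow> bounded_clinear (\<lambda>x. f (g x))"
  by (auto simp: bounded_clinear_def intro: bounded_linear_compose)

lemma bounded_clinear_plus: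
  "bounded_clinear f \<Longrightarrow> bounded_clinear g \<Longrightarrow> bounded_clinear (\<lambda>x. f x + g x)"
  by (auto simp: bounded_clinear_def scaleC_add_right intro: bounded_linear_add)

lemma bounded_clinear_minus_op:
  "bounded_clinear f \<Longrightarrow> bounded_clinear (\<lambda>x. - f x)"
  by (auto simp: bounded_clinear_def intro: bounded_linear_minus)

lemma bounded_clinear_sub:
  "bounded_clinear f \<Longrightarrow> bounded_clinear g \<Longrightarrow> bounded_clinear (\<lambda>x. f x - g x)"
  by (auto simp: bounded_clinear_def complex_vector.scale_right_diff_distrib
      intro: bounded_linear_sub)

lemma bounded_clinear_scaleC_op:
  assumes f: "bounded_clinear f"
  shows "bounded_clinear (\<lambda>x. c *\<^sub>C f x)"
proof -
  obtain K where K: "\<And>x. norm (f x) \<le> K * norm x"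
    using bounded_clinear_bound[OF f] by blast
  show ?thesis
  proof (rule bounded_clinearI[where K = "cmod c * K"])
    show "norm (c *\<^sub>C f x) \<le> cmod c * K * norm x" for x
      using mult_left_mono[OF K[of x], of "cmod c"] by (simp add: norm_scaleC mult.assoc)
  qed (simp_all add: bounded_clinear_add[OF f] bounded_clinear_scaleC[OF f] scaleC_add_right
      scaleC_scaleC mult.commute)
qed

lemma bounded_clinear_fst: "bounded_clinear fst"
  by (simp add: bounded_clinear_def bounded_linear_fst scaleC_prod_def)

lemma bounded_clinear_snd: "bounded_clinear snd"
  by (simp add: bounded_clinear_def bounded_linear_snd scaleC_prod_def)

lemma bounded_clinear_Pair:
  "bounded_clinear f \<Longrightarrow> bounded_clinear g \<Longrightarrow> bounded_clinear (\<lambda>x. (f x, g x))"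
  by (auto simp: bounded_clinear_def scaleC_prod_def intro: bounded_linear_Pair)

lemmas bounded_clinear_intros = bounded_clinear_id bounded_clinear_const_zero
  bounded_clinear_plus bounded_clinear_minus_op bounded_clinear_sub bounded_clinear_scaleC_op
  bounded_clinear_Pair bounded_clinear_compose[OF bounded_clinear_fst]
  bounded_clinear_compose[OF bounded_clinear_snd]

lemma invertible_opI:
  assumes "bounded_clinear f" "bounded_clinear g" "\<And>x. g (f x) = x" "\<And>x. f (g x) = x"
  shows "invertible_op f"
  using assms by (auto simp: invertible_op_def fun_eq_iff)

lemma invertible_opE:
  assumes "invertible_op f"
  obtains g where "bounded_clinear f" "bounded_clinear g" "\<And>x. g (f x) = x" "\<And>x. f (g x) = x"
  using assms by (auto simp: invertible_op_def fun_eq_iff)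

lemma invertible_op_inv:
  assumes "invertible_op f"
  shows "bounded_clinear (inv f)" "inv f (f x) = x" "f (inv f y) = y"
proof -
  obtain g where g: "bounded_clinear g" "\<And>x. g (f x) = x" "\<And>x. f (g x) = x"
    using assms by (rule invertible_opE) blast
  then have "inv f = g"
    by (intro inv_equality)
  with g show "bounded_clinear (inv f)" "inv f (f x) = x" "f (inv f y) = y"
    by auto
qed

lemma invertible_op_inverse:
  assumes "invertible_op f"
  shows "invertible_op (inv f)"
  using assms invertible_op_inv[OF assms] by (intro invertible_opI[of _ f]) (auto simp: invertible_op_def)

lemma invertible_op_id: "invertible_op (\<lambda>x. x)"
  by (rule invertible_opI) (auto intro: bounded_clinear_intros)

lemma invertible_op_compose:
  assumes f: "invertible_op f" and g: "invertible_op g"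
  shows "invertible_op (\<lambda>x. f (g x))"
proof -
  obtain f' where f': "bounded_clinear f" "bounded_clinear f'" "\<And>x. f' (f x) = x" "\<And>x. f (f' x) = x"
    using f by (rule invertible_opE) blast
  obtain g' where g': "bounded_clinear g" "bounded_clinear g'" "\<And>x. g' (g x) = x" "\<And>x. g (g' x) = x"
    using g by (rule invertible_opE) blast
  show ?thesis
    by (rule invertible_opI[where g = "\<lambda>x. g' (f' x)"])
      (simp_all add: f' g' bounded_clinear_compose)
qed

section \<open>Fredholm operators\<close>

lemma finite_cdim_iff:
  "finite_cdim S \<longleftrightarrow> complex_vector.subspace S \<and> (\<exists>B. finite B \<and> S \<subseteq> complex_vector.span B)"
proof
  assume "finite_cdim S"
  then show "complex_vector.subspace S \<and> (\<exists>B. finite B \<and> S \<subseteq> complex_vector.span B)"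
    by (auto simp: finite_cdim_def)
next
  assume S: "complex_vector.subspace S \<and> (\<exists>B. finite B \<and> S \<subseteq> complex_vector.span B)"
  then obtain B where B: "finite B" "S \<subseteq> complex_vector.span B"
    by blast
  obtain A where A: "A \<subseteq> S" "complex_vector.independent A" "S \<subseteq> complex_vector.span A"
    using complex_vector.maximal_independent_subset by blast
  have "finite A"
    using complex_vector.independent_span_bound[OF B(1) A(2)] A(1) B(2) by auto
  moreover have "complex_vector.span A = S"
    using S A complex_vector.span_minimal by blast
  ultimately show "finite_cdim S"
    unfolding finite_cdim_def by blast
qed

lemma subspace_kernel:
  assumes "bounded_clinear f"
  shows "complex_vector.subspace (kernel f)"
  by (rule complex_vector.subspaceI) (auto simp: kernel_def bounded_clinear_add[OF assms]
      bounded_clinear_zero[OF assms] bounded_clinear_scaleC[OF assms])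

lemma subspace_range:
  assumes "bounded_clinear f"
  shows "complex_vector.subspace (range f)"
  using complex_vector_pair.linear_subspace_image[OF bounded_clinear_linear[OF assms]]
  by simp

lemma span_subspace_Un_eq_UNIV:
  assumes "complex_vector.subspace R"
  shows "complex_vector.span (R \<union> B) = UNIV \<longleftrightarrow> (\<forall>y. \<exists>r\<in>R. y - r \<in> complex_vector.span B)"
proof -
  have R: "complex_vector.span R = R"
    using assms by simp
  have "(\<exists>r\<in>R. y - r \<in> complex_vector.span B) \<longleftrightarrow> y \<in> complex_vector.span (R \<union> B)" for y
  proof
    assume "\<exists>r\<in>R. y - r \<in> complex_vector.span B"
    then obtain r where "r \<in> R" "y - r \<in> complex_vector.span B"
      by blast
    then have "r + (y - r) \<in> complex_vector.span (R \<union> B)"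
      unfolding complex_vector.span_Un R by blast
    then show "y \<in> complex_vector.span (R \<union> B)"
      by simp
  next
    assume "y \<in> complex_vector.span (R \<union> B)"
    then obtain r b where "y = r + b" "r \<in> R" "b \<in> complex_vector.span B"
      unfolding complex_vector.span_Un R by blast
    then show "\<exists>r\<in>R. y - r \<in> complex_vector.span B"
      by (intro bexI[of _ r]) auto
  qed
  then show ?thesis
    by auto
qed

lemma fredholmI:
  assumes "bounded_clinear f" "finite A" "kernel f \<subseteq> complex_vector.span A"
    "finite B" "\<And>y. \<exists>x. y - f x \<in> complex_vector.span B"
  shows "fredholm f"
  using assms unfolding fredholm_def finite_cdim_iff finite_ccodim_def
  by (auto simp: subspace_kernel span_subspace_Un_eq_UNIV[OF subspace_range])

lemma fredholmE:
  assumes "fredholm f"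
  obtains A B where "bounded_clinear f" "finite A" "kernel f \<subseteq> complex_vector.span A"
    "finite B" "\<And>y. \<exists>x. y - f x \<in> complex_vector.span B"
proof -
  have f: "bounded_clinear f" and "finite_cdim (kernel f)" and "finite_ccodim (range f)"
    using assms by (auto simp: fredholm_def)
  moreover from \<open>finite_ccodim (range f)\<close> obtain B where
    "finite B" "complex_vector.span (range f \<union> B) = UNIV"
    unfolding finite_ccodim_def by blast
  ultimately show ?thesis
    using that[of _ B] by (auto simp: finite_cdim_iff span_subspace_Un_eq_UNIV[OF subspace_range])
qed

text \<open>The kernel of \<open>U\<close> lies in that of G U and the range of \<open>U\<close>
  contains that of U H, so the finiteness of kernel and cokernel comes from one product
  each.\<close>

lemma fredholm_if_fredholm_products:
  assumes U: "bounded_clinear U"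
    and l: "fredholm Z" "G 0 = 0" "\<And>x. G (U x) = Z x"
    and r: "fredholm Z'" "\<And>x. U (H x) = Z' x"
  shows "fredholm U"
proof -
  obtain A where "finite A" "kernel Z \<subseteq> complex_vector.span A"
    by (rule fredholmE[OF l(1)]) blast
  moreover obtain B where "finite B" "\<And>y. \<exists>x. y - Z' x \<in> complex_vector.span B"
    by (rule fredholmE[OF r(1)]) blast
  moreover have "kernel U \<subseteq> kernel Z"
    by (auto simp: kernel_def l(2) l(3)[symmetric])
  ultimately show ?thesis
    using U r(2) by (intro fredholmI[of U A B]) (auto, metis)
qed

text \<open>The intertwining S (I - T S) = (I - S T) S transfers both finiteness conditions along
  \<open>S\<close>: a \<open>y\<close> in the second kernel is the image of \<open>T y\<close> in
  the first, and if \<open>x\<close> solves the first equation for \<open>T y\<close> up to span B,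
  then \<open>y + S x\<close> solves the second for \<open>y\<close> up to span (S B).\<close>

lemma fredholm_id_minus_commute:
  assumes S: "bounded_clinear S" and T: "bounded_clinear T"
    and TS: "fredholm (\<lambda>x. x - T (S x))"
  shows "fredholm (\<lambda>y. y - S (T y))"
proof -
  obtain A B where W: "finite A" "kernel (\<lambda>x. x - T (S x)) \<subseteq> complex_vector.span A"
    "finite B" "\<And>y. \<exists>x. y - (x - T (S x)) \<in> complex_vector.span B"
    by (rule fredholmE[OF TS]) blast
  note span_S = complex_vector_pair.linear_span_image[OF bounded_clinear_linear[OF S]]
  have "y \<in> complex_vector.span (S ` A)" if "y = S (T y)" for y
  proof -
    have "T y = T (S (T y))"
      using that by simp
    then have "T y \<in> complex_vector.span A"
      using W(2) by (auto simp: kernel_def)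
    then show ?thesis
      using that span_S by (metis imageI)
  qed
  moreover have "\<exists>z. y - (z - S (T z)) \<in> complex_vector.span (S ` B)" for y
  proof -
    obtain x where "T y - (x - T (S x)) \<in> complex_vector.span B"
      using W(4) by blast
    then have "S (T y - (x - T (S x))) \<in> complex_vector.span (S ` B)"
      by (simp add: span_S)
    moreover have "S (T y - (x - T (S x))) = y - ((y + S x) - S (T (y + S x)))"
      by (simp add: bounded_clinear_diff[OF S] bounded_clinear_add[OF S] bounded_clinear_add[OF T])
    ultimately show ?thesis
      by metis
  qed
  moreover have "bounded_clinear (\<lambda>y. y - S (T y))"
    by (intro bounded_clinear_sub bounded_clinear_id bounded_clinear_compose[OF S T])
  ultimately show ?thesis
    using finite_imageI[OF W(1)] finite_imageI[OF W(3)]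
    by (intro fredholmI[of _ "S ` A" "S ` B"]) (simp_all add: kernel_def subset_iff)
qed

lemma essentially_incomparable_iff:
  "essentially_incomparable TYPE('x :: complex_banach) TYPE('y :: complex_banach) \<longleftrightarrow>
    (\<forall>(S :: 'x \<Rightarrow> 'y) (T :: 'y \<Rightarrow> 'x). bounded_clinear S \<longrightarrow> bounded_clinear T \<longrightarrow>
      fredholm (\<lambda>x. x - T (S x)))"
  by (auto simp: essentially_incomparable_def inessential_def)

lemma essentially_incomparable_commute:
  assumes "essentially_incomparable TYPE('x :: complex_banach) TYPE('y :: complex_banach)"
  shows "essentially_incomparable TYPE('y) TYPE('x)"
  using assms fredholm_id_minus_commute unfolding essentially_incomparable_iff by blast

section \<open>Equivalence after extension\<close>

lemma
  assumes "bounded_clinear_on S T f"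
  shows bounded_clinear_on_mem: "x \<in> S \<Longrightarrow> f x \<in> T"
    and bounded_clinear_on_add: "x \<in> S \<Longrightarrow> y \<in> S \<Longrightarrow> f (x + y) = f x + f y"
    and bounded_clinear_on_scaleC: "x \<in> S \<Longrightarrow> f (c *\<^sub>C x) = c *\<^sub>C f x"
    and bounded_clinear_on_bound: "\<exists>K. \<forall>x\<in>S. norm (f x) \<le> K * norm x"
  using assms unfolding bounded_clinear_on_def by blast+

text \<open>The (1,1) block is defined on the whole type even though \<open>G\<close> is controlled
  only on \<open>UNIV \<times> S\<close>. The corners of E, F and their inverses thereby become
  operators between the two spaces, to which incomparability applies.\<close>

lemma bounded_clinear_on_fst_corner:
  fixes G :: "'a :: complex_normed_vector \<times> 'w :: complex_normed_vector \<Rightarrow>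
    'b :: complex_normed_vector \<times> 'w"
  assumes G: "bounded_clinear_on (UNIV \<times> S) (UNIV \<times> T) G" and "0 \<in> S"
  shows "bounded_clinear (\<lambda>x. fst (G (x, 0)))"
proof -
  obtain K where K: "\<And>z. z \<in> UNIV \<times> S \<Longrightarrow> norm (G z) \<le> K * norm z"
    using bounded_clinear_on_bound[OF G] by blast
  have add: "G (x + y, 0) = G (x, 0) + G (y, 0)" for x y
  proof -
    have "G ((x, 0) + (y, 0)) = G (x, 0) + G (y, 0)"
      by (rule bounded_clinear_on_add[OF G]) (simp_all add: \<open>0 \<in> S\<close>)
    then show ?thesis
      by simp
  qed
  have scale: "G (c *\<^sub>C x, 0) = c *\<^sub>C G (x, 0)" for c x
  proof -
    have "G (c *\<^sub>C (x, 0)) = c *\<^sub>C G (x, 0)"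
      by (rule bounded_clinear_on_scaleC[OF G]) (simp add: \<open>0 \<in> S\<close>)
    then show ?thesis
      by (simp add: scaleC_prod_def)
  qed
  have "norm (fst (G (x, 0))) \<le> K * norm x" for x
  proof -
    have "norm (fst (G (x, 0))) \<le> norm (G (x, 0))"
      using norm_fst_le[of "fst (G (x, 0))" "snd (G (x, 0))"] by simp
    also have "\<dots> \<le> K * norm (x, 0 :: 'w)"
      using K \<open>0 \<in> S\<close> by blast
    finally show ?thesis
      by simp
  qed
  then show ?thesis
    by (intro bounded_clinearI[where K = K]) (simp_all add: add scale scaleC_prod_def)
qed

lemma equivalent_after_extension_commute:
  fixes U :: "'a :: complex_banach \<Rightarrow> 'a" and V :: "'b :: complex_banach \<Rightarrow> 'b"
  assumes "equivalent_after_extension TYPE('w :: complex_banach) U V"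
  shows "equivalent_after_extension TYPE('w) V U"
proof -
  obtain X0 Y0 :: "'w set" and E F where
    sub: "closed_csubspace X0" "closed_csubspace Y0" and
    E: "invertible_op_on (UNIV \<times> Y0) (UNIV \<times> X0) E" and
    F: "invertible_op_on (UNIV \<times> X0) (UNIV \<times> Y0) F" and
    eq: "\<And>z. z \<in> UNIV \<times> X0 \<Longrightarrow> map_prod U id z = E (map_prod V id (F z))"
    using assms unfolding equivalent_after_extension_def by blast
  obtain E' where E': "bounded_clinear_on (UNIV \<times> X0) (UNIV \<times> Y0) E'"
    "\<And>z. z \<in> UNIV \<times> Y0 \<Longrightarrow> E' (E z) = z" "\<And>z. z \<in> UNIV \<times> X0 \<Longrightarrow> E (E' z) = z"
    using E unfolding invertible_op_on_def by blast
  obtain F' where F': "bounded_clinear_on (UNIV \<times> Y0) (UNIV \<times> X0) F'"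
    "\<And>z. z \<in> UNIV \<times> X0 \<Longrightarrow> F' (F z) = z" "\<And>z. z \<in> UNIV \<times> Y0 \<Longrightarrow> F (F' z) = z"
    using F unfolding invertible_op_on_def by blast
  have "map_prod V id w = E' (map_prod U id (F' w))" if "w \<in> UNIV \<times> Y0" for w
  proof -
    have "F' w \<in> UNIV \<times> X0"
      by (rule bounded_clinear_on_mem[OF F'(1) that])
    then have "map_prod U id (F' w) = E (map_prod V id w)"
      using eq F'(3) that by simp
    then show ?thesis
      using E'(2)[of "map_prod V id w"] that by auto
  qed
  moreover have "invertible_op_on (UNIV \<times> X0) (UNIV \<times> Y0) E'"
    "invertible_op_on (UNIV \<times> Y0) (UNIV \<times> X0) F'"
    using E E' F F' unfolding invertible_op_on_def by blast+
  ultimately show ?thesis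
    unfolding equivalent_after_extension_def using sub by blast
qed

text \<open>
  Write \<open>E'\<close> and \<open>F'\<close> for the inverses of \<open>E\<close> and \<open>F\<close>, and index the blocks of the four
  operators. With \<open>G = F'\<^sub>1\<^sub>2 E'\<^sub>2\<^sub>1\<close> one finds
  \<open>G U = I - F'\<^sub>1\<^sub>1 F\<^sub>1\<^sub>1\<close> and \<open>U G = I - E\<^sub>1\<^sub>1 E'\<^sub>1\<^sub>1\<close>, and the products on the right factor
  through the other space.
\<close>

lemma fredholm_if_equivalent_after_extension:
  fixes U :: "'a :: complex_banach \<Rightarrow> 'a" and V :: "'b :: complex_banach \<Rightarrow> 'b"
  assumes inc: "essentially_incomparable TYPE('a) TYPE('b)"
    and U: "bounded_clinear U"
    and eae: "equivalent_after_extension TYPE('w :: complex_banach) U V"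
  shows "fredholm U"
proof -
  obtain X0 Y0 :: "'w set" and E F where
    sub: "closed_csubspace X0" "closed_csubspace Y0" and
    E: "invertible_op_on (UNIV \<times> Y0) (UNIV \<times> X0) E" and
    F: "invertible_op_on (UNIV \<times> X0) (UNIV \<times> Y0) F" and
    eq: "\<And>z. z \<in> UNIV \<times> X0 \<Longrightarrow> map_prod U id z = E (map_prod V id (F z))"
    using eae unfolding equivalent_after_extension_def by blast
  obtain E' where E': "bounded_clinear_on (UNIV \<times> X0) (UNIV \<times> Y0) E'"
    "\<And>z. z \<in> UNIV \<times> Y0 \<Longrightarrow> E' (E z) = z" "\<And>z. z \<in> UNIV \<times> X0 \<Longrightarrow> E (E' z) = z"
    using E unfolding invertible_op_on_def by blast
  obtain F' where F': "bounded_clinear_on (UNIV \<times> Y0) (UNIV \<times> X0) F'"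
    "\<And>z. z \<in> UNIV \<times> X0 \<Longrightarrow> F' (F z) = z" "\<And>z. z \<in> UNIV \<times> Y0 \<Longrightarrow> F (F' z) = z"
    using F unfolding invertible_op_on_def by blast
  have bE: "bounded_clinear_on (UNIV \<times> Y0) (UNIV \<times> X0) E"
    and bF: "bounded_clinear_on (UNIV \<times> X0) (UNIV \<times> Y0) F"
    using E F by (auto simp: invertible_op_on_def)
  have 0: "0 \<in> X0" "0 \<in> Y0"
    using sub by (auto simp: closed_csubspace_def complex_vector.subspace_0)
  have split: "fst (H (fst z, 0)) + fst (H (0, snd z)) = fst (H z)"
    if H: "bounded_clinear_on (UNIV \<times> S) (UNIV \<times> T) H" and "z \<in> UNIV \<times> S" "0 \<in> S"
    for H :: "'c :: complex_banach \<times> 'w \<Rightarrow> 'd :: complex_banach \<times> 'w" and S T z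
  proof -
    have "H ((fst z, 0) + (0, snd z)) = H (fst z, 0) + H (0, snd z)"
      by (rule bounded_clinear_on_add[OF H]) (use that(2,3) in auto)
    then show ?thesis
      by (metis add.right_neutral add_0 add_Pair fst_add prod.collapse)
  qed
  have H0: "H 0 = 0" if H: "bounded_clinear_on (UNIV \<times> S) (UNIV \<times> T) H" and "0 \<in> S"
    for H :: "'c :: complex_banach \<times> 'w \<Rightarrow> 'd :: complex_banach \<times> 'w" and S T
  proof -
    have "H (0 + 0) = H 0 + H 0"
      by (rule bounded_clinear_on_add[OF H]) (simp_all add: zero_prod_def that(2))
    then show ?thesis
      by simp
  qed
  define G where "G x = fst (F' (0, snd (E' (x, 0))))" for x
  have F_in: "F z \<in> UNIV \<times> Y0" if "z \<in> UNIV \<times> X0" for z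
    by (rule bounded_clinear_on_mem[OF bF that])
  have F'_in: "F' z \<in> UNIV \<times> X0" if "z \<in> UNIV \<times> Y0" for z
    by (rule bounded_clinear_on_mem[OF F'(1) that])
  have E'_in: "E' z \<in> UNIV \<times> Y0" if "z \<in> UNIV \<times> X0" for z
    by (rule bounded_clinear_on_mem[OF E'(1) that])
  have GU: "G (U x) = x - fst (F' (fst (F (x, 0)), 0))" for x
  proof -
    have z: "(x, 0) \<in> UNIV \<times> X0"
      using 0 by simp
    \<comment> \<open>With \<open>E\<close> moved to the left, the second coordinates no longer
      involve \<open>V\<close>: this is the block identity E'_21 U = F_21, to be inserted into the
      (1,1) block of F' F = I.\<close>
    have "E' (map_prod U id (x, 0)) = map_prod V id (F (x, 0))"
      using eq[OF z] E'(2)[of "map_prod V id (F (x, 0))"] F_in[OF z] by auto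
    then have "snd (E' (U x, 0)) = snd (F (x, 0))"
      by simp
    moreover have "fst (F' (fst (F (x, 0)), 0)) + fst (F' (0, snd (F (x, 0)))) = x"
      using split[OF F'(1) F_in[OF z]] F'(2)[OF z] 0 by simp
    ultimately show ?thesis
      by (simp add: G_def eq_diff_eq add.commute)
  qed
  have UG: "U (G x) = x - fst (E (fst (E' (x, 0)), 0))" for x
  proof -
    have z: "(x, 0) \<in> UNIV \<times> X0"
      using 0 by simp
    have w: "(0, snd (E' (x, 0))) \<in> UNIV \<times> Y0"
      using E'_in[OF z] by auto
    \<comment> \<open>The mirror image: on vectors with first coordinate 0 the sum of
      \<open>V\<close> and the identity acts as the identity, which gives E_12 = U F'_12.\<close>
    have "E (0, snd (E' (x, 0))) = E (map_prod V id (F (F' (0, snd (E' (x, 0))))))"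
    proof -
      \<comment> \<open>\<open>V\<close> is just a function in this lemma, so its value at 0 is read
        off from the factorization at 0 after cancelling \<open>E\<close>.\<close>
      have "V 0 = 0"
      proof -
        have "map_prod V id (F 0) = E' (E (map_prod V id (F 0)))"
          using E'(2)[of "map_prod V id (F 0)"] F_in[of 0] 0 by (auto simp: zero_prod_def)
        also have "E (map_prod V id (F 0)) = map_prod U id 0"
          using eq[of 0] 0 by (simp add: zero_prod_def)
        also have "\<dots> = 0"
          by (simp add: zero_prod_def bounded_clinear_zero[OF U])
        finally show "V 0 = 0"
          using H0[OF E'(1) 0(1)] H0[OF bF 0(1)] by (simp add: zero_prod_def)
      qed
      then show ?thesis
        using F'(3)[OF w] by simp
    qed
    also have "\<dots> = map_prod U id (F' (0, snd (E' (x, 0))))"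
      using eq[OF F'_in[OF w]] by simp
    finally have "fst (E (0, snd (E' (x, 0)))) = U (G x)"
      by (simp add: G_def)
    moreover have "fst (E (fst (E' (x, 0)), 0)) + fst (E (0, snd (E' (x, 0)))) = x"
      using split[OF bE E'_in[OF z]] E'(3)[OF z] 0 by simp
    ultimately show ?thesis
      by (simp add: eq_diff_eq add.commute)
  qed
  have "G 0 = 0"
    using H0[OF E'(1) 0(1)] H0[OF F'(1) 0(2)] by (simp add: G_def zero_prod_def)
  moreover have "fredholm (\<lambda>x. x - fst (F' (fst (F (x, 0)), 0)))"
    "fredholm (\<lambda>x. x - fst (E (fst (E' (x, 0)), 0)))"
    using inc bounded_clinear_on_fst_corner[OF bF 0(1)] bounded_clinear_on_fst_corner[OF F'(1) 0(2)]
      bounded_clinear_on_fst_corner[OF bE 0(2)] bounded_clinear_on_fst_corner[OF E'(1) 0(1)]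
    unfolding essentially_incomparable_iff by blast+
  ultimately show ?thesis
    using fredholm_if_fredholm_products[of U _ G _ G, OF U _ _ GU _ UG] by blast
qed

text \<open>The block matrix with identities on the diagonal and \<open>T\<close>, \<open>S\<close>
  off it can be cleared from either corner, leaving I - T S or I - S T beside an identity.
  \<open>F\<close> and \<open>E\<close> collect the two column and the two row shears that relate
  these reductions, together with a flip of the coordinates.\<close>

lemma equivalent_after_extension_id_minus:
  fixes S :: "'x :: complex_banach \<Rightarrow> 'y :: complex_banach" and T :: "'y \<Rightarrow> 'x"
  assumes S: "bounded_clinear S" and T: "bounded_clinear T"
  shows "equivalent_after_extension TYPE('x \<times> 'y \<times> 'u :: complex_banach)
    (\<lambda>x. x - T (S x)) (\<lambda>y. y - S (T y))"
proof -
  \<comment> \<open>The extension spaces are exchanged: Y extends X and X extends Y, both as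
    coordinate subspaces of the ambient space.\<close>
  define i :: "'y \<Rightarrow> 'x \<times> 'y \<times> 'u" where "i = (\<lambda>y. (0, y, 0))"
  define j :: "'x \<Rightarrow> 'x \<times> 'y \<times> 'u" where "j = (\<lambda>x. (x, 0, 0))"
  define E where "E = (\<lambda>w :: 'y \<times> 'x. (snd w - T (fst w + S (snd w)), fst w + S (snd w)))"
  define F where "F = (\<lambda>z :: 'x \<times> 'y. (snd z - S (fst z), fst z + T (snd z - S (fst z))))"
  note bounded = bounded_clinear_compose[OF S] bounded_clinear_compose[OF T] bounded_clinear_intros
    bounded_clinear_fst bounded_clinear_snd
  note algebra = bounded_clinear_add[OF S] bounded_clinear_add[OF T]
    bounded_clinear_diff[OF S] bounded_clinear_diff[OF T]
  have E: "invertible_op E"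
    by (rule invertible_opI[where
          g = "\<lambda>z. (snd z - S (fst z + T (snd z)), fst z + T (snd z))"])
      (auto simp: E_def algebra intro!: bounded)
  have F: "invertible_op F"
    by (rule invertible_opI[where
          g = "\<lambda>w. (snd w - T (fst w), fst w + S (snd w - T (fst w)))"])
      (auto simp: F_def algebra intro!: bounded)
  have eq: "map_prod (\<lambda>x. x - T (S x)) id z = E (map_prod (\<lambda>y. y - S (T y)) id (F z))" for z
    by (cases z) (simp add: E_def F_def algebra)
  have ni: "norm (i y) = norm y" and nj: "norm (j x) = norm x" for x y
    by (simp_all add: i_def j_def norm_prod_def)
  have bi: "bounded_clinear i" and bj: "bounded_clinear j"
    unfolding i_def j_def by (intro bounded_clinear_intros)+
  have inv: "inv i (i y) = y" "inv j (j x) = x" for x y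
    by (rule inv_f_f, simp add: i_def j_def inj_def)+
  have "map_prod (\<lambda>x. x - T (S x)) id z =
      (map_prod id i \<circ> E \<circ> map_prod id (inv j)) (map_prod (\<lambda>y. y - S (T y)) id
        ((map_prod id j \<circ> F \<circ> map_prod id (inv i)) z))"
    if z: "z \<in> UNIV \<times> range i" for z
  proof -
    obtain x y where z_eq: "z = map_prod id i (x, y)"
      using z by auto
    obtain p q where F_eq: "F (x, y) = (p, q)"
      by fastforce
    have "map_prod id i (map_prod (\<lambda>x. x - T (S x)) id (x, y)) =
        map_prod id i (E (map_prod (\<lambda>y. y - S (T y)) id (F (x, y))))"
      by (simp only: eq)
    then show ?thesis
      by (simp add: z_eq inv F_eq)
  qed
  then show ?thesis
    unfolding equivalent_after_extension_def
    using closed_csubspace_range_isometry[OF bi ni] closed_csubspace_range_isometry[OF bj nj]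
      invertible_op_on_transport[OF bj nj bi ni E] invertible_op_on_transport[OF bi ni bj nj F]
    by (intro exI conjI ballI)
qed

section \<open>Functionals and projections\<close>

text \<open>
  Hahn-Banach in the form needed here: a minimal sublinear functional below a given one is
  linear, since \<open>shrink m y = m\<close> forces \<open>m x + m y \<le> m (x + y)\<close>. This avoids partially
  defined functionals.
\<close>

definition sublinear :: "('a :: real_vector \<Rightarrow> real) \<Rightarrow> bool" where
  "sublinear p \<longleftrightarrow> (\<forall>x y. p (x + y) \<le> p x + p y) \<and> (\<forall>r\<ge>0. \<forall>x. p (r *\<^sub>R x) \<le> r * p x)"

lemma sublinear_add: "sublinear p \<Longrightarrow> p (x + y) \<le> p x + p y"
  and sublinear_scaleR: "sublinear p \<Longrightarrow> 0 \<le> r \<Longrightarrow> p (r *\<^sub>R x) \<le> r * p x"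
  by (simp_all add: sublinear_def)

lemma sublinear_zero:
  assumes "sublinear p" shows "p 0 = 0"
  using sublinear_add[OF assms, of 0 0] sublinear_scaleR[OF assms, of 0 0] by simp

lemma sublinear_lower_bound:
  assumes "sublinear p" shows "- p (- x) \<le> p x"
  using sublinear_add[OF assms, of x "- x"] sublinear_zero[OF assms] by simp

text \<open>The chain condition is what yields subadditivity: for \<open>p\<close> and
  \<open>q\<close> in \<open>C\<close> the smaller of the two bounds the infimum at
  \<open>x + y\<close> by \<open>p x + q y\<close>, so the two infima on the right can be taken
  independently.\<close>

lemma sublinear_INF:
  fixes C :: "('a :: real_vector \<Rightarrow> real) set"
  assumes "C \<noteq> {}" and C: "\<And>p. p \<in> C \<Longrightarrow> sublinear p"
    and bdd: "\<And>x. bdd_below ((\<lambda>p. p x) ` C)"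
    and chain: "\<And>p q. p \<in> C \<Longrightarrow> q \<in> C \<Longrightarrow> p \<le> q \<or> q \<le> p"
  shows "sublinear (\<lambda>x. INF p\<in>C. p x)"
  unfolding sublinear_def
proof (intro conjI allI impI)
  fix x y
  have *: "(INF r\<in>C. r (x + y)) \<le> p x + q y" if pq: "p \<in> C" "q \<in> C" for p q
  proof -
    obtain r where r: "r \<in> C" "r \<le> p" "r \<le> q"
      using chain[OF pq] pq by auto
    have "(INF r\<in>C. r (x + y)) \<le> r (x + y)"
      by (rule cINF_lower[OF bdd r(1)])
    also have "\<dots> \<le> r x + r y"
      by (rule sublinear_add[OF C[OF r(1)]])
    finally show ?thesis
      using r(2,3) by (meson add_mono le_funD order_trans)
  qed
  have "(INF r\<in>C. r (x + y)) - p x \<le> (INF q\<in>C. q y)" if "p \<in> C" for p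
    by (rule cINF_greatest[OF \<open>C \<noteq> {}\<close>]) (use *[OF that] in \<open>simp add: algebra_simps\<close>)
  then have "(INF r\<in>C. r (x + y)) - (INF q\<in>C. q y) \<le> (INF p\<in>C. p x)"
    by (intro cINF_greatest[OF \<open>C \<noteq> {}\<close>]) (simp add: algebra_simps)
  then show "(INF r\<in>C. r (x + y)) \<le> (INF p\<in>C. p x) + (INF q\<in>C. q y)"
    by simp
next
  fix s :: real and x :: 'a
  assume "0 \<le> s"
  have *: "(INF p\<in>C. p (s *\<^sub>R x)) \<le> s * p x" if "p \<in> C" for p
    using cINF_lower[OF bdd[of "s *\<^sub>R x"] that] sublinear_scaleR[OF C[OF that] \<open>0 \<le> s\<close>, of x]
    by linarith
  show "(INF p\<in>C. p (s *\<^sub>R x)) \<le> s * (INF p\<in>C. p x)"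
  proof (cases "s = 0")
    case True
    then show ?thesis
      using * \<open>C \<noteq> {}\<close> by fastforce
  next
    case False
    then have "s > 0"
      using \<open>0 \<le> s\<close> by simp
    have "(INF p\<in>C. p (s *\<^sub>R x)) / s \<le> (INF p\<in>C. p x)"
      by (rule cINF_greatest[OF \<open>C \<noteq> {}\<close>])
        (use * \<open>s > 0\<close> in \<open>simp add: pos_divide_le_eq mult.commute\<close>)
    then show ?thesis
      using \<open>s > 0\<close> by (simp add: pos_divide_le_eq mult.commute)
  qed
qed

text \<open>For sublinear \<open>p\<close> this is the largest sublinear \<open>q \<le> p\<close>
  with \<open>q (- y) \<le> - p y\<close>, that is, \<open>p\<close> lowered just enough to be
  linear along \<open>y\<close>.\<close>

definition shrink :: "('a :: real_vector \<Rightarrow> real) \<Rightarrow> 'a \<Rightarrow> 'a \<Rightarrow> real" where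
  "shrink p y x = (INF t\<in>{0..}. p (x + t *\<^sub>R y) - t * p y)"

text \<open>A real infimum is informative only for a set bounded below; here
  \<open>- p (- x)\<close> is a bound independent of \<open>t\<close>.\<close>

lemma shrink_lower:
  assumes p: "sublinear p" and "0 \<le> t"
  shows "shrink p y x \<le> p (x + t *\<^sub>R y) - t * p y"
proof -
  have "- p (- x) \<le> p (x + t *\<^sub>R y) - t * p y" if "0 \<le> t" for t
  proof -
    have "t * p y \<le> p (t *\<^sub>R y)"
    proof (cases "t = 0")
      case False
      with that show ?thesis
        using sublinear_scaleR[OF p, of "1 / t" "t *\<^sub>R y"] by (simp add: field_simps)
    qed (simp add: sublinear_zero[OF p])
    then show ?thesis
      using sublinear_add[OF p, of "x + t *\<^sub>R y" "- x"] by simp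
  qed
  then have "bdd_below ((\<lambda>t. p (x + t *\<^sub>R y) - t * p y) ` {0..})"
    by (intro bdd_belowI2[where m = "- p (- x)"]) simp
  then show ?thesis
    unfolding shrink_def by (rule cINF_lower) (simp add: assms(2))
qed

lemma shrink_greatest:
  assumes "\<And>t. 0 \<le> t \<Longrightarrow> m \<le> p (x + t *\<^sub>R y) - t * p y"
  shows "m \<le> shrink p y x"
  unfolding shrink_def by (rule cINF_greatest) (use assms in auto)

lemma shrink_le: "sublinear p \<Longrightarrow> shrink p y x \<le> p x"
  using shrink_lower[of p 0 y x] by simp

lemma sublinear_shrink:
  assumes p: "sublinear p"
  shows "sublinear (shrink p y)"
  unfolding sublinear_def
proof (intro conjI allI impI)
  fix u v
  have *: "shrink p y (u + v) \<le> (p (u + s *\<^sub>R y) - s * p y) + (p (v + t *\<^sub>R y) - t * p y)"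
    if "0 \<le> s" "0 \<le> t" for s t
    using shrink_lower[OF p, of "s + t" y "u + v"] that
      sublinear_add[OF p, of "u + s *\<^sub>R y" "v + t *\<^sub>R y"]
    by (simp add: algebra_simps)
  have "shrink p y (u + v) - (p (u + s *\<^sub>R y) - s * p y) \<le> shrink p y v" if "0 \<le> s" for s
    by (rule shrink_greatest) (use *[OF that] in \<open>simp add: algebra_simps\<close>)
  then have "shrink p y (u + v) - shrink p y v \<le> shrink p y u"
    by (intro shrink_greatest) (simp add: algebra_simps)
  then show "shrink p y (u + v) \<le> shrink p y u + shrink p y v"
    by simp
next
  fix r :: real and x
  assume "0 \<le> r"
  show "shrink p y (r *\<^sub>R x) \<le> r * shrink p y x"
  proof (cases "r = 0")
    case True
    then show ?thesis
      using shrink_le[OF p, of y 0] by (simp add: sublinear_zero[OF p])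
  next
    case False
    then have "r > 0"
      using \<open>0 \<le> r\<close> by simp
    have "shrink p y (r *\<^sub>R x) / r \<le> p (x + t *\<^sub>R y) - t * p y" if "0 \<le> t" for t
    proof -
      have "shrink p y (r *\<^sub>R x) \<le> p (r *\<^sub>R x + (r * t) *\<^sub>R y) - (r * t) * p y"
        using \<open>r > 0\<close> that by (intro shrink_lower[OF p]) simp
      also have "p (r *\<^sub>R x + (r * t) *\<^sub>R y) \<le> r * p (x + t *\<^sub>R y)"
        using sublinear_scaleR[OF p \<open>0 \<le> r\<close>, of "x + t *\<^sub>R y"] by (simp add: scaleR_add_right)
      finally show ?thesis
        using \<open>r > 0\<close> by (simp add: field_simps)
    qed
    then have "shrink p y (r *\<^sub>R x) / r \<le> shrink p y x"
      by (rule shrink_greatest)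
    then show ?thesis
      using \<open>r > 0\<close> by (simp add: pos_divide_le_eq mult.commute)
  qed
qed

text \<open>Zorn's lemma for the reversed order. Every sublinear \<open>q \<le> p\<close> stays
  above \<open>- p (- x)\<close> at \<open>x\<close>, so pointwise infima of nonempty chains are
  finite, and they are sublinear again.\<close>

lemma exists_minimal_sublinear:
  assumes p: "sublinear p"
  obtains m where "sublinear m" "m \<le> p" "\<And>q. sublinear q \<Longrightarrow> q \<le> m \<Longrightarrow> q = m"
proof -
  define A where "A = {q. sublinear q \<and> q \<le> p}"
  have "\<exists>m\<in>A. \<forall>q\<in>A. q \<le> m \<longrightarrow> q = m"
  proof (rule predicate_Zorn[where P = "\<lambda>q r. r \<le> q"])
    show "partial_order_on A (relation_of (\<lambda>q r. r \<le> q) A)"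
      by (rule partial_order_on_relation_ofI) auto
  next
    fix C
    assume "C \<in> Chains (relation_of (\<lambda>q r. r \<le> q) A)"
    then have C: "\<And>q. q \<in> C \<Longrightarrow> q \<in> A" "\<And>q r. q \<in> C \<Longrightarrow> r \<in> C \<Longrightarrow> q \<le> r \<or> r \<le> q"
      by (auto simp: Chains_def relation_of_def)
    show "\<exists>u\<in>A. \<forall>a\<in>C. u \<le> a"
    proof (cases "C = {}")
      case True
      then show ?thesis
        using p by (auto simp: A_def)
    next
      case False
      have "- p (- x) \<le> q x" if "q \<in> C" for q x
      proof -
        have "- p (- x) \<le> - q (- x)"
          using C(1)[OF that] by (simp add: A_def le_fun_def)
        also have "\<dots> \<le> q x"
          using C(1)[OF that] by (intro sublinear_lower_bound) (simp add: A_def)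
        finally show ?thesis .
      qed
      then have bdd: "bdd_below ((\<lambda>q. q x) ` C)" for x
        by (intro bdd_belowI2)
      have lower: "(\<lambda>x. INF q\<in>C. q x) \<le> q" if "q \<in> C" for q
        using cINF_lower[OF bdd that] by (simp add: le_fun_def)
      moreover have "sublinear (\<lambda>x. INF q\<in>C. q x)"
        using False C bdd by (intro sublinear_INF) (auto simp: A_def)
      moreover obtain q where "q \<in> C"
        using False by blast
      ultimately have "(\<lambda>x. INF q\<in>C. q x) \<in> A"
        using C(1)[OF \<open>q \<in> C\<close>] lower[OF \<open>q \<in> C\<close>] by (auto simp: A_def intro: order_trans)
      then show ?thesis
        using lower by blast
    qed
  qed
  then obtain m where "m \<in> A" "\<And>q. q \<in> A \<Longrightarrow> q \<le> m \<Longrightarrow> q = m"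
    by blast
  then show ?thesis
    using that by (auto simp: A_def)
qed

lemma minimal_sublinear_linear:
  assumes m: "sublinear m" and min: "\<And>q. sublinear q \<Longrightarrow> q \<le> m \<Longrightarrow> q = m"
  shows "linear m"
proof -
  have "m x \<le> m (x + y) - m y" for x y
  proof -
    have "shrink m y = m"
      by (rule min[OF sublinear_shrink[OF m]]) (simp add: le_fun_def shrink_le[OF m])
    then show ?thesis
      using shrink_lower[OF m, of 1 y x] by simp
  qed
  then have add: "m (x + y) = m x + m y" for x y
    using sublinear_add[OF m, of x y] by (smt (verit))
  have minus: "m (- x) = - m x" for x
    using add[of x "- x"] by (simp add: sublinear_zero[OF m])
  have scale: "m (r *\<^sub>R x) = r * m x" if "0 \<le> r" for r x
    using sublinear_scaleR[OF m that, of x] sublinear_scaleR[OF m that, of "- x"] by (simp add: minus)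
  have "m (r *\<^sub>R x) = r * m x" for r x
    using scale[of r x] scale[of "- r" x] minus[of "r *\<^sub>R x"] by (cases "0 \<le> r") auto
  then show ?thesis
    by (intro linearI) (simp_all add: add)
qed

text \<open>Minimizing below \<open>shrink norm v\<close> instead of \<open>norm\<close> builds in
  the value at \<open>v\<close>: the parameter t = 1 at \<open>- v\<close> gives
  \<open>f (- v) \<le> - norm v\<close>, and linearity turns this into the missing
  inequality.\<close>

lemma exists_supporting_functional:
  fixes v :: "'a :: real_normed_vector"
  obtains f where "linear f" "\<And>x. f x \<le> norm x" "f v = norm v"
proof -
  have n: "sublinear (norm :: 'a \<Rightarrow> real)"
    by (simp add: sublinear_def norm_triangle_ineq)
  obtain f where f: "sublinear f" "f \<le> shrink norm v" "\<And>q. sublinear q \<Longrightarrow> q \<le> f \<Longrightarrow> q = f"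
    using exists_minimal_sublinear[OF sublinear_shrink[OF n]] by blast
  have "linear f"
    using f by (intro minimal_sublinear_linear)
  moreover have le: "f x \<le> norm x" for x
    using f(2) shrink_le[OF n, of v x] by (auto simp: le_fun_def intro: order_trans)
  moreover have "f (- v) \<le> - norm v"
    using f(2) shrink_lower[OF n, of 1 v "- v"] by (auto simp: le_fun_def intro: order_trans)
  ultimately show ?thesis
    using that[of f] linear_neg[of f v] le[of v] by simp
qed

text \<open>The usual complexification x -> f x - i f (i x) of a real functional. Its real part at
  \<open>v\<close> is \<open>norm v\<close>, hence it can be normalized there; the constant 2 comes
  from adding the bounds for real and imaginary part.\<close>

lemma exists_bounded_clinear_functional:
  fixes v :: "'a :: complex_normed_vector"
  assumes "v \<noteq> 0"
  obtains \<phi> :: "'a \<Rightarrow> complex" where "bounded_clinear \<phi>" "\<phi> v = 1"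
proof -
  obtain f where f: "linear f" "\<And>x. f x \<le> norm x" "f v = norm v"
    using exists_supporting_functional[of v] by blast
  have abs_f: "\<bar>f x\<bar> \<le> norm x" for x
    using f(2)[of x] f(2)[of "- x"] by (simp add: linear_neg[OF f(1)])
  define \<psi> where "\<psi> x = Complex (f x) (- f (\<i> *\<^sub>C x))" for x
  have \<psi>: "bounded_clinear \<psi>"
  proof (rule bounded_clinearI[where K = 2])
    show "\<psi> (x + y) = \<psi> x + \<psi> y" for x y
      by (simp add: \<psi>_def complex_eq_iff scaleC_add_right linear_add[OF f(1)])
    show "\<psi> (c *\<^sub>C x) = c *\<^sub>C \<psi> x" for c x
    proof -
      have 1: "c *\<^sub>C x = Re c *\<^sub>R x + Im c *\<^sub>R \<i> *\<^sub>C x"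
      proof -
        have "c = complex_of_real (Re c) + complex_of_real (Im c) * \<i>"
          by (simp add: complex_eq_iff)
        then have "c *\<^sub>C x = (complex_of_real (Re c) + complex_of_real (Im c) * \<i>) *\<^sub>C x"
          by simp
        then show ?thesis
          by (simp only: scaleC_add_left flip: scaleC_scaleC scaleC_of_real)
      qed
      have "\<i> *\<^sub>C \<i> *\<^sub>C x = - x"
        using scaleC_of_real[of "- 1" x] by (simp add: scaleC_scaleC)
      then have 2: "\<i> *\<^sub>C c *\<^sub>C x = Re c *\<^sub>R \<i> *\<^sub>C x - Im c *\<^sub>R x"
        by (simp add: 1 scaleC_add_right scaleC_scaleC mult.commute flip: scaleC_of_real)
      show ?thesis
        unfolding \<psi>_def 1 2[unfolded 1]
        by (simp add: complex_eq_iff scaleC_complex_def linear_add[OF f(1)] linear_diff[OF f(1)]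
            linear_scale[OF f(1)])
    qed
    show "norm (\<psi> x) \<le> 2 * norm x" for x
      using cmod_le[of "\<psi> x"] abs_f[of x] abs_f[of "\<i> *\<^sub>C x"] by (simp add: \<psi>_def norm_scaleC)
  qed
  have "Re (\<psi> v) \<noteq> 0"
    using assms by (simp add: \<psi>_def f(3))
  then have "\<psi> v \<noteq> 0"
    by auto
  then show ?thesis
    using that[of "\<lambda>x. inverse (\<psi> v) *\<^sub>C \<psi> x"] bounded_clinear_scaleC_op[OF \<psi>]
    by (simp add: scaleC_complex_def)
qed

lemma bounded_clinear_functional_scaleC:
  fixes \<phi> :: "'a :: complex_normed_vector \<Rightarrow> complex" and w :: "'b :: complex_normed_vector"
  assumes \<phi>: "bounded_clinear \<phi>"
  shows "bounded_clinear (\<lambda>x. \<phi> x *\<^sub>C w)"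
proof -
  obtain K where K: "\<And>x. norm (\<phi> x) \<le> K * norm x"
    using bounded_clinear_bound[OF \<phi>] by blast
  show ?thesis
  proof (rule bounded_clinearI[where K = "K * norm w"])
    show "norm (\<phi> x *\<^sub>C w) \<le> K * norm w * norm x" for x
      using mult_right_mono[OF K[of x], of "norm w"] by (simp add: norm_scaleC mult_ac)
  qed (simp_all add: bounded_clinear_add[OF \<phi>] bounded_clinear_scaleC[OF \<phi>] scaleC_add_left
      scaleC_complex_def scaleC_scaleC)
qed

text \<open>A new vector \<open>b\<close> matters only through \<open>w = b - P b\<close>. On the
  larger span \<open>x - P x\<close> is a multiple of \<open>w\<close>, and a functional with value
  1 at \<open>w\<close> recovers the coefficient, so a rank-one correction of \<open>P\<close>
  suffices.\<close>

lemma exists_bounded_projection: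
  fixes B :: "'a :: complex_normed_vector set"
  assumes "finite B"
  shows "\<exists>P :: 'a \<Rightarrow> 'a. bounded_clinear P \<and> range P \<subseteq> complex_vector.span B \<and>
    (\<forall>x \<in> complex_vector.span B. P x = x)"
  using assms
proof (induction B)
  case empty
  show ?case
    by (rule exI[of _ "\<lambda>x. 0"]) (auto intro: bounded_clinear_const_zero)
next
  case (insert b B)
  then obtain P :: "'a \<Rightarrow> 'a" where P: "bounded_clinear P" "\<And>x. P x \<in> complex_vector.span B"
    "\<And>x. x \<in> complex_vector.span B \<Longrightarrow> P x = x"
    by blast
  show ?case
  proof (cases "b \<in> complex_vector.span B")
    case True
    then show ?thesis
      using P by (intro exI[of _ P]) (auto simp: complex_vector.span_redundant)
  next
    case False
    define w where "w = b - P b"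
    have "w \<noteq> 0"
      using False P(2)[of b] by (auto simp: w_def)
    then obtain \<phi> :: "'a \<Rightarrow> complex" where \<phi>: "bounded_clinear \<phi>" "\<phi> w = 1"
      by (rule exists_bounded_clinear_functional)
    have mono: "x \<in> complex_vector.span (insert b B)" if "x \<in> complex_vector.span B" for x
      using that complex_vector.span_mono[of B "insert b B"] by blast
    have w: "w \<in> complex_vector.span (insert b B)"
      unfolding w_def by (intro complex_vector.span_diff complex_vector.span_base mono P(2)) simp
    let ?Q = "\<lambda>x. P x + \<phi> (x - P x) *\<^sub>C w"
    have "bounded_clinear (\<lambda>x. \<phi> (x - P x))"
      by (rule bounded_clinear_compose[OF \<phi>(1) bounded_clinear_sub[OF bounded_clinear_id P(1)]])
    then have "bounded_clinear ?Q"
      by (intro bounded_clinear_plus P(1) bounded_clinear_functional_scaleC)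
    moreover have "?Q x \<in> complex_vector.span (insert b B)" for x
      by (intro complex_vector.span_add complex_vector.span_scale mono w P(2))
    moreover have "?Q x = x" if x: "x \<in> complex_vector.span (insert b B)" for x
    proof -
      obtain k where "x - k *\<^sub>C b \<in> complex_vector.span B"
        using x unfolding complex_vector.span_breakdown_eq by blast
      then have "P (x - k *\<^sub>C b) = x - k *\<^sub>C b"
        by (rule P(3))
      then have "x - P x = k *\<^sub>C w"
        by (simp add: w_def complex_vector.scale_right_diff_distrib bounded_clinear_diff[OF P(1)]
            bounded_clinear_scaleC[OF P(1)] algebra_simps)
      then have "\<phi> (x - P x) *\<^sub>C w = x - P x"
        using \<phi> by (simp add: bounded_clinear_scaleC scaleC_complex_def)
      then show ?thesis
        by simp
    qed
    ultimately show ?thesis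
      by blast
  qed
qed

section \<open>Bounded inverses\<close>

lemma surjective_approximation:
  fixes f :: "'a :: real_normed_vector \<Rightarrow> 'b :: banach"
  assumes f: "bounded_linear f" "surj f"
  obtains M where "M > 0" "\<And>y. \<exists>x. norm x \<le> M * norm y \<and> norm (y - f x) \<le> norm y / 2"
proof -
  interpret f: bounded_linear f
    by (rule f(1))
  define S where "S n = closure (f ` cball 0 (real n))" for n :: nat
  have "\<exists>n. interior (S n) \<noteq> {}"
  proof (rule ccontr)
    assume "\<nexists>n. interior (S n) \<noteq> {}"
    then have "euclidean interior_of \<Union> (range S) = {}"
      by (intro Baire_category_alt) (auto simp: completely_metrizable_space_euclidean S_def)
    moreover have "y \<in> \<Union> (range S)" for y
    proof -
      obtain x where "f x = y"
        using f(2) by (metis surjD)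
      moreover have "f x \<in> S (nat \<lceil>norm x\<rceil>)"
        unfolding S_def
        by (rule subsetD[OF closure_subset], rule imageI) (simp add: real_nat_ceiling_ge)
      ultimately show ?thesis
        by auto
    qed
    ultimately show False
      by (metis UNIV_eq_I empty_not_UNIV interior_of_topspace topspace_euclidean)
  qed
  then obtain n y0 r where r: "r > 0" "ball y0 r \<subseteq> S n"
    by (metis all_not_in_conv mem_interior)
  have approx: "\<exists>x. norm x \<le> 2 * real n \<and> norm (z - f x) < 2 * e" if "norm z < r" "e > 0" for z e
  proof -
    \<comment> \<open>Subtracting approximate preimages of \<open>y0 + z\<close> and
      \<open>y0\<close> moves the ball's centre to 0, at the price of doubling the radius
      \<open>n\<close> and the error.\<close>
    have "y0 + z \<in> S n" "y0 \<in> S n"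
      using r that by (auto simp: dist_norm intro!: subsetD[OF r(2)])
    then obtain x1 x2 where x: "norm x1 \<le> real n" "dist (f x1) (y0 + z) < e"
      "norm x2 \<le> real n" "dist (f x2) y0 < e"
      unfolding S_def closure_approachable using \<open>e > 0\<close> by fastforce
    have eq: "z - f (x1 - x2) = - (f x1 - (y0 + z)) + (f x2 - y0)"
      by (simp add: f.diff)
    have "norm (z - f (x1 - x2)) < 2 * e"
      using norm_triangle_ineq[of "- (f x1 - (y0 + z))" "f x2 - y0"] x(2,4)
      unfolding eq dist_norm norm_minus_cancel by linarith
    moreover have "norm (x1 - x2) \<le> 2 * real n"
      using norm_triangle_ineq4[of x1 x2] x by simp
    ultimately show ?thesis
      by blast
  qed
  show ?thesis
  proof (rule that[of "(4 * real n + 1) / r"])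
    show "(4 * real n + 1) / r > 0"
      using r(1) by simp
    fix y
    show "\<exists>x. norm x \<le> (4 * real n + 1) / r * norm y \<and> norm (y - f x) \<le> norm y / 2"
    proof (cases "y = 0")
      case True
      then show ?thesis
        by (intro exI[of _ 0]) (simp add: f.zero)
    next
      case False
      \<comment> \<open>Division by \<open>s\<close> gives \<open>y\<close> the norm r/2. The error
        r/4 scales back to \<open>norm y / 2\<close>, and the bound 2n scales back to 4n
        \<open>norm y\<close> / r; the extra 1 in the constant keeps it positive for n = 0.\<close>
      define s where "s = 2 * norm y / r"
      have "s > 0"
        using False r(1) by (simp add: s_def)
      have "norm ((1 / s) *\<^sub>R y) < r"
        using False r(1) by (simp add: s_def)
      then obtain x where x: "norm x \<le> 2 * real n" "norm ((1 / s) *\<^sub>R y - f x) < 2 * (r / 8)"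
        using approx[of "(1 / s) *\<^sub>R y" "r / 8"] r(1) by auto
      have "y - f (s *\<^sub>R x) = s *\<^sub>R ((1 / s) *\<^sub>R y - f x)"
        using \<open>s > 0\<close> by (simp add: f.scaleR scaleR_diff_right)
      then have "norm (y - f (s *\<^sub>R x)) = s * norm ((1 / s) *\<^sub>R y - f x)"
        using \<open>s > 0\<close> by simp
      also have "\<dots> \<le> s * (2 * (r / 8))"
        using x(2) \<open>s > 0\<close> by (intro mult_left_mono) auto
      also have "\<dots> = norm y / 2"
        using r(1) by (simp add: s_def)
      finally have "norm (y - f (s *\<^sub>R x)) \<le> norm y / 2" .
      moreover have "norm (s *\<^sub>R x) \<le> (4 * real n + 1) / r * norm y"
      proof -
        have "norm (s *\<^sub>R x) \<le> s * (2 * real n)"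
          using x(1) \<open>s > 0\<close> by simp
        also have "\<dots> \<le> (4 * real n + 1) / r * norm y"
          using r(1) by (simp add: s_def field_simps)
        finally show ?thesis .
      qed
      ultimately show ?thesis
        by blast
    qed
  qed
qed

text \<open>Approximate solving is iterated on the residuals \<open>r n\<close>. They halve at each
  step, so the corrections \<open>g (r n)\<close> sum absolutely, and the images telescope to
  \<open>y\<close>. The geometric series contributes the factor 2.\<close>

lemma open_mapping_bound:
  fixes f :: "'a :: banach \<Rightarrow> 'b :: banach"
  assumes f: "bounded_linear f" "surj f"
  obtains M where "M > 0" "\<And>y. \<exists>x. f x = y \<and> norm x \<le> M * norm y"
proof -
  interpret f: bounded_linear f
    by (rule f(1))
  obtain M g where M: "M > 0" and g: "\<And>y. norm (g y) \<le> M * norm y"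
    "\<And>y. norm (y - f (g y)) \<le> norm y / 2"
    using surjective_approximation[OF f] by metis
  have "\<exists>x. f x = y \<and> norm x \<le> (2 * M) * norm y" for y
  proof -
    define r where "r n = ((\<lambda>z. z - f (g z)) ^^ n) y" for n
    have r_Suc: "r (Suc n) = r n - f (g (r n))" for n
      by (simp add: r_def)
    have r_le: "norm (r n) \<le> norm y * (1 / 2) ^ n" for n
    proof (induction n)
      case (Suc n)
      then show ?case
        using g(2)[of "r n"] by (simp add: r_Suc)
    qed (simp add: r_def)
    have "(\<lambda>n. norm y * (1 / 2) ^ n) \<longlonglongrightarrow> norm y * 0"
      by (intro tendsto_mult tendsto_const LIMSEQ_power_zero) simp
    then have "(\<lambda>n. norm y * (1 / 2) ^ n) \<longlonglongrightarrow> 0"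
      by simp
    then have "r \<longlonglongrightarrow> 0"
      by (rule Lim_null_comparison[rotated]) (simp add: r_le)
    then have fg_sums: "(\<lambda>n. f (g (r n))) sums y"
      using telescope_sums'[of r 0] by (simp add: r_Suc) (simp add: r_def)
    have g_le: "norm (g (r n)) \<le> M * norm y * (1 / 2) ^ n" for n
      using order_trans[OF g(1)[of "r n"] mult_left_mono[OF r_le[of n], of M]] M
      by (simp add: mult.assoc)
    have geo: "(\<lambda>n. M * norm y * (1 / 2) ^ n) sums (M * norm y * 2)"
      using sums_mult[OF geometric_sums[of "1 / 2 :: real"], of "M * norm y"] by simp
    have summ: "summable (\<lambda>n. norm (g (r n)))"
      by (rule summable_comparison_test'[OF sums_summable[OF geo], of 0]) (simp add: g_le)
    have "(\<lambda>n. f (g (r n))) sums f (\<Sum>n. g (r n))"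
      by (rule f.sums[OF summable_sums[OF summable_norm_cancel[OF summ]]])
    then have "f (\<Sum>n. g (r n)) = y"
      using fg_sums sums_unique2 by blast
    moreover have "norm (\<Sum>n. g (r n)) \<le> (2 * M) * norm y"
    proof -
      have "norm (\<Sum>n. g (r n)) \<le> (\<Sum>n. norm (g (r n)))"
        by (rule summable_norm[OF summ])
      also have "\<dots> \<le> (\<Sum>n. M * norm y * (1 / 2) ^ n)"
        by (rule suminf_le[OF g_le summ sums_summable[OF geo]])
      also have "\<dots> = (2 * M) * norm y"
        using sums_unique[OF geo] by simp
      finally show ?thesis .
    qed
    ultimately show ?thesis
      by blast
  qed
  then show ?thesis
    using that[of "2 * M"] M by simp
qed

text \<open>Solving x + K x = y means finding a fixed point of x -> y - K x. The estimate (1 - c)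
  |x| \<le> |x + K x| then gives uniqueness, hence linearity of the solution map, and its
  bound.\<close>

lemma invertible_op_id_plus_contraction:
  fixes K :: "'a :: complex_banach \<Rightarrow> 'a"
  assumes K: "bounded_clinear K" and c: "c < 1" "\<And>x. norm (K x) \<le> c * norm x"
  shows "invertible_op (\<lambda>x. x + K x)"
proof -
  have b: "bounded_clinear (\<lambda>x. x + K x)"
    by (intro bounded_clinear_plus bounded_clinear_id K)
  have sol: "\<exists>x. x + K x = y" for y
  proof -
    \<comment> \<open>On the trivial space \<open>c\<close> may be negative, whereas the fixed-point
      theorem asks for a nonnegative constant.\<close>
    have "max c 0 \<ge> 0" "max c 0 < 1"
      using c(1) by auto
    moreover have "dist (y - K u) (y - K v) \<le> max c 0 * dist u v" for u v
    proof -
      have "dist (y - K u) (y - K v) = norm (K (v - u))"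
        by (simp add: dist_norm bounded_clinear_diff[OF K])
      also have "\<dots> \<le> max c 0 * norm (v - u)"
        using c(2)[of "v - u"] by (meson max.cobounded1 mult_right_mono norm_ge_zero order_trans)
      finally show ?thesis
        by (simp add: dist_norm norm_minus_commute)
    qed
    ultimately obtain x where "y - K x = x"
      using banach_fix_type[of "max c 0" "\<lambda>x. y - K x"] by blast
    then show ?thesis
      by (metis diff_add_cancel)
  qed
  have lower: "(1 - c) * norm x \<le> norm (x + K x)" for x
    using c(2)[of x] norm_triangle_ineq4[of "x + K x" "K x"] by (simp add: algebra_simps)
  have inj: "x = z" if "x + K x = z + K z" for x z
  proof -
    have "(x - z) + K (x - z) = 0"
      using that by (simp add: bounded_clinear_diff[OF K] algebra_simps)
    then have "(1 - c) * norm (x - z) \<le> 0"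
      using lower[of "x - z"] by simp
    then show ?thesis
      using c(1) by (simp add: mult_le_0_iff)
  qed
  obtain g where g: "\<And>y. g y + K (g y) = y"
    using sol by metis
  have "bounded_clinear g"
  proof (rule bounded_clinearI[where K = "1 / (1 - c)"])
    show "g (x + y) = g x + g y" for x y
    proof (rule inj)
      have "g x + g y + K (g x + g y) = (g x + K (g x)) + (g y + K (g y))"
        by (simp add: bounded_clinear_add[OF K])
      then show "g (x + y) + K (g (x + y)) = g x + g y + K (g x + g y)"
        by (simp only: g)
    qed
    show "g (a *\<^sub>C x) = a *\<^sub>C g x" for a x
      by (rule inj) (simp add: g bounded_clinear_scaleC[OF K] flip: scaleC_add_right)
    show "norm (g x) \<le> 1 / (1 - c) * norm x" for x
      using lower[of "g x"] c(1) by (simp add: g field_simps)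
  qed
  moreover have "g (x + K x) = x" for x
    by (rule inj) (rule g)
  ultimately show ?thesis
    by (rule invertible_opI[OF b _ _ g])
qed

section \<open>Finite-rank perturbations of invertible operators\<close>

definition finite_rank ::
  "('a :: complex_normed_vector \<Rightarrow> 'b :: complex_normed_vector) \<Rightarrow> bool" where
  "finite_rank F \<longleftrightarrow>
    bounded_clinear F \<and> (\<exists>B. finite B \<and> range F \<subseteq> complex_vector.span B)"

lemma finite_rank_bounded_clinear: "finite_rank F \<Longrightarrow> bounded_clinear F"
  by (simp add: finite_rank_def)

lemma finite_rankE:
  assumes "finite_rank F"
  obtains B where "finite B" "\<And>x. F x \<in> complex_vector.span B"
  using assms unfolding finite_rank_def by blast

lemma finite_rankI:
  assumes "bounded_clinear F" "finite B" "\<And>x. F x \<in> complex_vector.span B"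
  shows "finite_rank F"
  using assms unfolding finite_rank_def by blast

lemma finite_rank_compose_left:
  assumes F: "finite_rank F" and G: "bounded_clinear G"
  shows "finite_rank (\<lambda>x. G (F x))"
proof -
  obtain B where B: "finite B" "\<And>x. F x \<in> complex_vector.span B"
    using finite_rankE[OF F] by blast
  have "G (F x) \<in> complex_vector.span (G ` B)" for x
    using B(2)[of x] complex_vector_pair.linear_span_image[OF bounded_clinear_linear[OF G], of B]
    by blast
  then show ?thesis
    by (rule finite_rankI[OF bounded_clinear_compose[OF G finite_rank_bounded_clinear[OF F]]
          finite_imageI[OF B(1)]])
qed

lemma finite_rank_compose_right:
  assumes F: "finite_rank F" and G: "bounded_clinear G"
  shows "finite_rank (\<lambda>x. F (G x))"
proof -
  obtain B where B: "finite B" "\<And>x. F x \<in> complex_vector.span B"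
    using finite_rankE[OF F] by blast
  then show ?thesis
    by (intro finite_rankI[OF bounded_clinear_compose[OF finite_rank_bounded_clinear[OF F] G]])
qed

lemma finite_rank_sub:
  assumes F: "finite_rank F" and G: "finite_rank G"
  shows "finite_rank (\<lambda>x. F x - G x)"
proof -
  obtain B where B: "finite B" "\<And>x. F x \<in> complex_vector.span B"
    using finite_rankE[OF F] by blast
  obtain C where C: "finite C" "\<And>x. G x \<in> complex_vector.span C"
    using finite_rankE[OF G] by blast
  have "F x - G x \<in> complex_vector.span (B \<union> C)" for x
    using B(2)[of x] C(2)[of x] complex_vector.span_mono[of B "B \<union> C"]
      complex_vector.span_mono[of C "B \<union> C"]
    by (intro complex_vector.span_diff) auto
  then show ?thesis
    by (rule finite_rankI[OF bounded_clinear_sub[OF finite_rank_bounded_clinear[OF F]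
          finite_rank_bounded_clinear[OF G]] finite_UnI[OF B(1) C(1)]])
qed

lemma finite_rank_zero: "finite_rank (\<lambda>x. 0)"
  by (rule finite_rankI[of _ "{}"]) (auto intro: bounded_clinear_const_zero)

lemma finite_rank_minus: "finite_rank F \<Longrightarrow> finite_rank (\<lambda>x. - F x)"
  using finite_rank_sub[OF finite_rank_zero, of F] by simp

text \<open>
  These are exactly the Fredholm operators of index \<open>0\<close>; working with the decomposition
  avoids computing kernels and ranges of products.
\<close>

definition weyl :: "('a :: complex_normed_vector \<Rightarrow> 'b :: complex_normed_vector) \<Rightarrow> bool" where
  "weyl W \<longleftrightarrow> (\<exists>V F. invertible_op V \<and> finite_rank F \<and> (\<forall>x. W x = V x + F x))"

lemma weylI:
  "invertible_op V \<Longrightarrow> finite_rank F \<Longrightarrow> (\<And>x. W x = V x + F x) \<Longrightarrow> weyl W"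
  unfolding weyl_def by blast

lemma weylE:
  assumes "weyl W"
  obtains V F where "invertible_op V" "finite_rank F" "\<And>x. W x = V x + F x"
  using assms unfolding weyl_def by blast

lemma weyl_invertible_compose:
  assumes A: "invertible_op A" and W: "weyl W"
  shows "weyl (\<lambda>x. A (W x))"
proof -
  obtain V F where V: "invertible_op V" and F: "finite_rank F" and W_eq: "\<And>x. W x = V x + F x"
    using weylE[OF W] by blast
  have "bounded_clinear A"
    using A by (simp add: invertible_op_def)
  then show ?thesis
    by (intro weylI[OF invertible_op_compose[OF A V] finite_rank_compose_left[OF F]])
      (simp_all add: W_eq bounded_clinear_add)
qed

text \<open>Substituting the inverse of \<open>V\<close> gives G = V' V^-1 + (F' - G F) V^-1, and
  finite-rank operators form an ideal. Together with its mirror image below this lets the property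
  pass between two factors whose product has it.\<close>

lemma weyl_left_factor:
  assumes W: "weyl W" and G: "bounded_clinear G" and GW: "weyl (\<lambda>x. G (W x))"
  shows "weyl G"
proof -
  obtain V F where V: "invertible_op V" and F: "finite_rank F" and W_eq: "\<And>x. W x = V x + F x"
    using weylE[OF W] by blast
  obtain V' F' where V': "invertible_op V'" and F': "finite_rank F'"
    and GW_eq: "\<And>x. G (W x) = V' x + F' x"
    using weylE[OF GW] by blast
  note inv_V = invertible_op_inv[OF V]
  show ?thesis
  proof (rule weylI)
    show "invertible_op (\<lambda>y. V' (inv V y))"
      by (rule invertible_op_compose[OF V' invertible_op_inverse[OF V]])
    show "finite_rank (\<lambda>y. F' (inv V y) - G (F (inv V y)))"
      by (rule finite_rank_compose_right[OF finite_rank_sub[OF F' finite_rank_compose_left[OF F G]]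
            inv_V(1)])
    show "G y = V' (inv V y) + (F' (inv V y) - G (F (inv V y)))" for y
    proof -
      have "y = W (inv V y) - F (inv V y)"
        by (simp add: W_eq inv_V)
      then have "G y = G (W (inv V y)) - G (F (inv V y))"
        by (metis bounded_clinear_diff[OF G])
      then show ?thesis
        by (simp add: GW_eq)
    qed
  qed
qed

lemma weyl_right_factor:
  assumes G: "weyl G" and W: "bounded_clinear W" and GW: "weyl (\<lambda>x. G (W x))"
  shows "weyl W"
proof -
  obtain V F where V: "invertible_op V" and F: "finite_rank F" and G_eq: "\<And>x. G x = V x + F x"
    using weylE[OF G] by blast
  obtain V' F' where V': "invertible_op V'" and F': "finite_rank F'"
    and GW_eq: "\<And>x. G (W x) = V' x + F' x"
    using weylE[OF GW] by blast
  note inv_V = invertible_op_inv[OF V]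
  show ?thesis
  proof (rule weylI)
    show "invertible_op (\<lambda>x. inv V (V' x))"
      by (rule invertible_op_compose[OF invertible_op_inverse[OF V] V'])
    show "finite_rank (\<lambda>x. inv V (F' x - F (W x)))"
      by (rule finite_rank_compose_left[OF finite_rank_sub[OF F' finite_rank_compose_right[OF F W]]
            inv_V(1)])
    show "W x = inv V (V' x) + inv V (F' x - F (W x))" for x
    proof -
      have "V (W x) = V' x + (F' x - F (W x))"
        using GW_eq[of x] by (simp add: G_eq algebra_simps)
      then show ?thesis
        by (metis bounded_clinear_add[OF inv_V(1)] inv_V(2))
    qed
  qed
qed

section \<open>The index\<close>

text \<open>A linear map that vanishes on \<open>S\<close> and fixes \<open>T\<close> both kills and
  fixes \<open>v\<close>.\<close>

lemma independent_Un_span_Int: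
  fixes S T :: "'a :: complex_normed_vector set"
  assumes "complex_vector.independent (S \<union> T)" "S \<inter> T = {}"
    "v \<in> complex_vector.span S" "v \<in> complex_vector.span T"
  shows "v = 0"
proof -
  obtain g :: "'a \<Rightarrow> 'a" where g: "Vector_Spaces.linear scaleC scaleC g"
    "\<And>x. x \<in> S \<union> T \<Longrightarrow> g x = (if x \<in> S then 0 else x)"
    using complex_vector_pair.linear_independent_extend[OF assms(1), of "\<lambda>x. if x \<in> S then 0 else x"]
    by blast
  have "g v = 0"
    using complex_vector_pair.linear_eq_0_on_span[OF g(1) _ assms(3)] g(2) by simp
  moreover have "g v = v"
    using complex_vector_pair.linear_eq_on[OF g(1) complex_vector.linear_ident assms(4)]
      g(2) assms(2) by fastforce
  ultimately show ?thesis
    by simp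
qed

text \<open>The projection \<pi> onto span C along \<open>R\<close> kills \<open>R\<close>, so it
  sends any competing \<open>B\<close> to a spanning set of span C; independence of \<open>C\<close>
  then bounds its size by that of \<open>B\<close>.\<close>

lemma ccodim_eq_card:
  fixes R C :: "'a :: complex_normed_vector set"
  assumes R: "complex_vector.subspace R"
    and C: "finite C" "complex_vector.independent C" "complex_vector.span (R \<union> C) = UNIV"
    and Int: "R \<inter> complex_vector.span C = {0}"
  shows "ccodim R = card C"
  unfolding ccodim_def
proof (rule Least_equality)
  show "\<exists>B. finite B \<and> card B = card C \<and> complex_vector.span (R \<union> B) = UNIV"
    using C by blast
next
  fix n
  assume "\<exists>B. finite B \<and> card B = n \<and> complex_vector.span (R \<union> B) = UNIV"
  then obtain B where B: "finite B" "card B = n" "complex_vector.span (R \<union> B) = UNIV"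
    by blast
  have "\<exists>c. c \<in> complex_vector.span C \<and> y - c \<in> R" for y
  proof -
    obtain r where "r \<in> R" "y - r \<in> complex_vector.span C"
      using C(3) span_subspace_Un_eq_UNIV[OF R] by blast
    then show ?thesis
      by (intro exI[of _ "y - r"]) simp
  qed
  then obtain \<pi> where \<pi>: "\<And>y. \<pi> y \<in> complex_vector.span C" "\<And>y. y - \<pi> y \<in> R"
    by metis
  have unique: "\<pi> y = c" if "c \<in> complex_vector.span C" "y - c \<in> R" for y c
  proof -
    have "(y - c) - (y - \<pi> y) \<in> R"
      by (rule complex_vector.subspace_diff[OF R that(2) \<pi>(2)])
    moreover have "\<pi> y - c \<in> complex_vector.span C"
      by (rule complex_vector.span_diff[OF \<pi>(1) that(1)])
    ultimately have "\<pi> y - c \<in> R \<inter> complex_vector.span C"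
      by simp
    then show ?thesis
      using Int by simp
  qed
  have lin: "Vector_Spaces.linear scaleC scaleC \<pi>"
    unfolding Vector_Spaces.linear_iff
  proof (intro conjI allI complex_vector.vector_space_axioms)
    show "\<pi> (x + y) = \<pi> x + \<pi> y" for x y
      using complex_vector.subspace_add[OF R \<pi>(2)[of x] \<pi>(2)[of y]]
      by (intro unique complex_vector.span_add \<pi>(1)) (simp add: algebra_simps)
    show "\<pi> (c *\<^sub>C x) = c *\<^sub>C \<pi> x" for c x
      using complex_vector.subspace_scale[OF R \<pi>(2)[of x], of c]
      by (intro unique complex_vector.span_scale \<pi>(1))
        (simp add: complex_vector.scale_right_diff_distrib)
  qed
  have "\<pi> r = 0" if "r \<in> R" for r
    by (rule unique) (use that complex_vector.span_zero in auto)
  then have "complex_vector.span (\<pi> ` (R \<union> B)) \<subseteq> complex_vector.span (\<pi> ` B)"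
    by (intro complex_vector.span_minimal complex_vector.subspace_span)
      (auto intro: complex_vector.span_base complex_vector.span_zero)
  then have "range \<pi> \<subseteq> complex_vector.span (\<pi> ` B)"
    using complex_vector_pair.linear_span_image[OF lin, of "R \<union> B"] B(3) by simp
  moreover have "\<pi> c = c" if "c \<in> C" for c
    by (rule unique) (use that R in \<open>auto intro: complex_vector.span_base complex_vector.subspace_0\<close>)
  ultimately have "C \<subseteq> complex_vector.span (\<pi> ` B)"
    by (metis rangeI subset_iff)
  then have "card C \<le> card (\<pi> ` B)"
    using complex_vector.independent_span_bound[OF _ C(2)] B(1) by simp
  also have "\<dots> \<le> n"
    using B card_image_le by blast
  finally show "card C \<le> n" .
qed

text \<open>Everything is reduced to a square matrix. Let \<open>M\<close> be a finite-dimensional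
  space containing the range of \<open>F\<close>, and \<open>N\<close> its preimage under
  \<open>V\<close>, of the same dimension. Kernel and cokernel of \<open>W\<close> are those of the
  restriction N -> M, and rank-nullity makes their dimensions equal.\<close>

lemma weyl_fredholm_index:
  fixes W :: "'a :: complex_banach \<Rightarrow> 'b :: complex_banach"
  assumes "weyl W"
  shows "fredholm W \<and> fredholm_index W = 0"
proof -
  obtain V F where V: "invertible_op V" and F: "finite_rank F" and W_eq: "\<And>x. W x = V x + F x"
    using weylE[OF assms] by blast
  have bV: "bounded_clinear V" and bW: "bounded_clinear W"
    using V bounded_clinear_plus[OF _ finite_rank_bounded_clinear[OF F], of V]
    by (auto simp: invertible_op_def W_eq[abs_def])
  note inv_V = invertible_op_inv[OF V]
  note linW = bounded_clinear_linear[OF bW] and lin_inv = bounded_clinear_linear[OF inv_V(1)]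
  obtain B0 where B0: "finite B0" "\<And>x. F x \<in> complex_vector.span B0"
    using finite_rankE[OF F] by blast
  obtain B where B: "B \<subseteq> B0" "complex_vector.independent B" "B0 \<subseteq> complex_vector.span B"
    using complex_vector.maximal_independent_subset by blast
  define M where "M = complex_vector.span B"
  define N where "N = complex_vector.span (inv V ` B)"
  have F_M: "F x \<in> M" for x
    using B0(2)[of x] B(3) complex_vector.span_minimal[OF _ complex_vector.subspace_span, of B0 B]
    unfolding M_def by blast
  have "finite B"
    using B(1) B0(1) finite_subset by blast
  have N_M: "x \<in> N \<longleftrightarrow> V x \<in> M" for x
  proof -
    have "N = inv V ` M"
      unfolding M_def N_def by (rule complex_vector_pair.linear_span_image[OF lin_inv])
    then show ?thesis
      by (metis image_iff inv_V(2,3))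
  qed
  have "inj (inv V)"
    by (metis injI inv_V(3))
  then have indN: "complex_vector.independent (inv V ` B)" and cardN: "card (inv V ` B) = card B"
    using complex_vector_pair.linear_independent_injective_image[OF lin_inv B(2)]
    by (auto intro: card_image inj_on_subset)
  \<comment> \<open>\<open>V\<close> and \<open>W\<close> agree modulo \<open>M\<close>, so they
    have the same preimage of \<open>M\<close>.\<close>
  have N: "x \<in> N \<longleftrightarrow> W x \<in> M" for x
  proof -
    have "V x = W x - F x"
      by (simp add: W_eq)
    then show ?thesis
      unfolding N_M M_def
      by (metis F_M M_def W_eq complex_vector.span_add complex_vector.span_diff)
  qed
  have ker_N: "kernel W \<subseteq> N"
    by (auto simp: kernel_def N M_def complex_vector.span_zero)
  obtain K0 where K0: "K0 \<subseteq> kernel W" "complex_vector.independent K0"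
    "kernel W \<subseteq> complex_vector.span K0"
    using complex_vector.maximal_independent_subset by blast
  obtain E where E: "K0 \<subseteq> E" "E \<subseteq> N" "complex_vector.independent E" "N \<subseteq> complex_vector.span E"
    using complex_vector.maximal_independent_subset_extend[of K0 N] K0 ker_N by blast
  have finE: "finite E" and cardE: "card E = card B"
  proof -
    show "finite E"
      using complex_vector.independent_span_bound[of "inv V ` B" E] E \<open>finite B\<close>
      by (auto simp: N_def)
    have "card E = complex_vector.dim N"
      by (rule complex_vector.basis_card_eq_dim[OF E(2,4,3)])
    then show "card E = card B"
      unfolding N_def complex_vector.dim_span_eq_card_independent[OF indN] cardN .
  qed
  define C1 where "C1 = E - K0"
  have C1: "complex_vector.independent C1" "C1 \<subseteq> N" "K0 \<union> C1 = E"
    using E complex_vector.independent_mono[of E C1] by (auto simp: C1_def)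
  have inj: "inj_on W (complex_vector.span C1)"
    unfolding complex_vector_pair.linear_inj_on_iff_eq_0[OF linW complex_vector.subspace_span]
  proof (intro ballI impI)
    fix x
    assume x: "x \<in> complex_vector.span C1" "W x = 0"
    then have "x \<in> complex_vector.span K0"
      using K0(3) by (auto simp: kernel_def)
    then show "x = 0"
      using independent_Un_span_Int[of K0 C1 x] E(3) C1(3) x(1) by (auto simp: C1_def)
  qed
  have WC1: "complex_vector.independent (W ` C1)" "card (W ` C1) = card C1" "W ` C1 \<subseteq> M"
  proof -
    show "complex_vector.independent (W ` C1)"
      by (rule complex_vector_pair.linear_independent_injective_image[OF linW C1(1) inj])
    show "card (W ` C1) = card C1"
      by (rule card_image[OF inj_on_subset[OF inj complex_vector.span_superset]])
    show "W ` C1 \<subseteq> M"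
      using C1(2) N by auto
  qed
  obtain D where D: "W ` C1 \<subseteq> D" "D \<subseteq> M" "complex_vector.independent D"
    "M \<subseteq> complex_vector.span D"
    using complex_vector.maximal_independent_subset_extend[OF WC1(3,1)] by blast
  have finD: "finite D" and cardD: "card D = card B"
  proof -
    show "finite D"
      using complex_vector.independent_span_bound[of B D] D \<open>finite B\<close> by (auto simp: M_def)
    have "card D = complex_vector.dim M"
      by (rule complex_vector.basis_card_eq_dim[OF D(2,4,3)])
    then show "card D = card B"
      unfolding M_def complex_vector.dim_span_eq_card_independent[OF B(2)] .
  qed
  \<comment> \<open>A basis of a complement of W(N) in \<open>M\<close>. As \<open>E\<close> and
    \<open>D\<close> have the same size, removing equally many vectors from each leaves
    \<open>card C = card K0\<close>.\<close>
  define C where "C = D - W ` C1"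
  have card_C: "card C = card K0"
  proof -
    have "card C = card D - card C1"
      unfolding C_def using D(1) finD WC1(2) by (metis card_Diff_subset finite_subset)
    also have "\<dots> = card K0"
      using E(1) finE cardD cardE card_Diff_subset[of K0 E] card_mono[of E K0]
      by (simp add: C1_def finite_subset)
    finally show ?thesis .
  qed
  have subR: "complex_vector.subspace (range W)"
    by (rule subspace_range[OF bW])
  have span_D: "complex_vector.span D \<subseteq> complex_vector.span (range W \<union> C)"
    by (rule complex_vector.span_mono) (auto simp: C_def)
  have "y \<in> complex_vector.span (range W \<union> C)" for y
  proof -
    have "W (inv V y) - F (inv V y) \<in> complex_vector.span (range W \<union> C)"
      using F_M D(4) span_D
      by (intro complex_vector.span_diff) (auto intro: complex_vector.span_base)
    then show ?thesis
      by (simp add: W_eq inv_V)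
  qed
  then have span_C: "complex_vector.span (range W \<union> C) = UNIV"
    by blast
  have "v = 0" if v: "v \<in> range W" "v \<in> complex_vector.span C" for v
  proof -
    have "complex_vector.span C \<subseteq> M"
      using D(2) unfolding M_def
      by (intro complex_vector.span_minimal) (auto simp: C_def)
    then obtain x where x: "v = W x" "x \<in> N"
      using v N by blast
    then have "v \<in> complex_vector.span (W ` E)"
      using E(4) complex_vector_pair.linear_span_image[OF linW, of E] by blast
    also have "complex_vector.span (W ` E) \<subseteq> complex_vector.span (W ` C1)"
    proof (intro complex_vector.span_minimal complex_vector.subspace_span image_subsetI)
      fix e
      assume "e \<in> E"
      then consider "W e = 0" | "e \<in> C1"
        using K0(1) C1(3) unfolding kernel_def by blast
      then show "W e \<in> complex_vector.span (W ` C1)"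
        by cases (auto intro: complex_vector.span_base complex_vector.span_zero)
    qed
    finally have "v \<in> complex_vector.span (W ` C1)" .
    moreover have "C \<union> W ` C1 = D"
      using D(1) by (auto simp: C_def)
    ultimately show ?thesis
      using independent_Un_span_Int[of C "W ` C1" v] v(2) D(3) by (auto simp: C_def)
  qed
  then have "range W \<inter> complex_vector.span C = {0}"
    using complex_vector.subspace_0[OF subR] complex_vector.span_zero by blast
  then have "ccodim (range W) = card K0"
    using ccodim_eq_card[OF subR _ _ span_C] finD D(3) card_C
      complex_vector.independent_mono[of D C] by (auto simp: C_def)
  moreover have "complex_vector.dim (kernel W) = card K0"
    using complex_vector.basis_card_eq_dim[OF K0(1,3,2)] by simp
  moreover have "fredholm W"
    unfolding fredholm_def finite_cdim_iff finite_ccodim_def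
    using bW subspace_kernel[OF bW] K0(3) E(1) finE span_C finD C_def finite_subset by blast
  ultimately show ?thesis
    by (simp add: fredholm_index_def)
qed

section \<open>Stability of the index along a segment\<close>

text \<open>A finite set that spans together with \<open>R\<close> may still meet \<open>R\<close>;
  the sum must be made direct before projecting. A vector is kept only if it lies outside the span
  reached so far, so no nontrivial combination involving it can fall into \<open>R\<close>.\<close>

lemma exists_finite_complement:
  fixes R :: "'a :: complex_normed_vector set"
  assumes R: "complex_vector.subspace R" and "finite B"
  shows "\<exists>C. finite C \<and> complex_vector.span (R \<union> B) \<subseteq> complex_vector.span (R \<union> C) \<and>
    R \<inter> complex_vector.span C = {0}"
  using \<open>finite B\<close>
proof (induction B)
  case empty
  show ?case
    using complex_vector.subspace_0[OF R] by (intro exI[of _ "{}"]) auto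
next
  case (insert b B)
  from insert.IH obtain C where C: "finite C"
    "complex_vector.span (R \<union> B) \<subseteq> complex_vector.span (R \<union> C)"
    "R \<inter> complex_vector.span C = {0}"
    by (elim exE conjE)
  have subset: "complex_vector.span (R \<union> insert b B) \<subseteq> complex_vector.span (R \<union> D)"
    if "b \<in> complex_vector.span (R \<union> D)"
      "complex_vector.span (R \<union> B) \<subseteq> complex_vector.span (R \<union> D)" for D
    using that complex_vector.span_superset[of "R \<union> B"]
    by (intro complex_vector.span_minimal complex_vector.subspace_span) blast
  show ?case
  proof (cases "b \<in> complex_vector.span (R \<union> C)")
    case True
    then show ?thesis
      using C(1,3) subset[OF True C(2)] by (intro exI[of _ C] conjI)
  next
    case False
    have "complex_vector.span (R \<union> insert b B) \<subseteq> complex_vector.span (R \<union> insert b C)"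
    proof (rule subset)
      show "b \<in> complex_vector.span (R \<union> insert b C)"
        by (rule complex_vector.span_base) simp
      have "complex_vector.span (R \<union> C) \<subseteq> complex_vector.span (R \<union> insert b C)"
        by (rule complex_vector.span_mono) blast
      then show "complex_vector.span (R \<union> B) \<subseteq> complex_vector.span (R \<union> insert b C)"
        using C(2) by blast
    qed
    moreover have "v = 0" if v: "v \<in> R" "v \<in> complex_vector.span (insert b C)" for v
    proof -
      obtain k where k: "v - k *\<^sub>C b \<in> complex_vector.span C"
        using v(2) unfolding complex_vector.span_breakdown_eq by blast
      have "k = 0"
      proof (rule ccontr)
        assume "k \<noteq> 0"
        have "v \<in> complex_vector.span (R \<union> C)"
          by (rule complex_vector.span_base) (simp add: v(1))
        moreover have "v - k *\<^sub>C b \<in> complex_vector.span (R \<union> C)"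
          using k complex_vector.span_mono[of C "R \<union> C"] by blast
        ultimately have "v - (v - k *\<^sub>C b) \<in> complex_vector.span (R \<union> C)"
          by (rule complex_vector.span_diff)
        then have "inverse k *\<^sub>C (v - (v - k *\<^sub>C b)) \<in> complex_vector.span (R \<union> C)"
          by (rule complex_vector.span_scale)
        then show False
          using False \<open>k \<noteq> 0\<close> by (simp add: scaleC_scaleC)
      qed
      then show ?thesis
        using k v(1) C(3) by auto
    qed
    then have "R \<inter> complex_vector.span (insert b C) = {0}"
      using complex_vector.subspace_0[OF R] complex_vector.span_zero by blast
    ultimately show ?thesis
      using C(1) by (intro exI[of _ "insert b C"] conjI finite.insertI)
  qed
qed

text \<open>
  With \<open>Q\<close> a bounded projection onto a complement of the range of \<open>W\<close>, the map
  \<open>(x, y) \<mapsto> W x + Q y\<close> is onto, so the open mapping theorem bounds its solutions; removing the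
  component of \<open>x\<close> in the kernel makes the choice of \<open>x\<close> unique and hence linear.
\<close>

lemma fredholm_left_parametrix:
  fixes W :: "'a :: complex_banach \<Rightarrow> 'b :: complex_banach"
  assumes "fredholm W"
  obtains G P where "bounded_clinear G" "finite_rank P" "\<And>x. G (W x) = x - P x"
proof -
  have W: "bounded_clinear W"
    using assms by (simp add: fredholm_def)
  obtain A where A: "finite A" "complex_vector.span A = kernel W"
    using assms unfolding fredholm_def finite_cdim_def by blast
  obtain P :: "'a \<Rightarrow> 'a" where P: "bounded_clinear P" "range P \<subseteq> kernel W"
    "\<And>x. x \<in> kernel W \<Longrightarrow> P x = x"
    using exists_bounded_projection[OF A(1)] A(2) by auto
  obtain B where B: "finite B" "complex_vector.span (range W \<union> B) = UNIV"
    using assms unfolding fredholm_def finite_ccodim_def by blast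
  obtain C where C: "finite C" "UNIV \<subseteq> complex_vector.span (range W \<union> C)"
    "range W \<inter> complex_vector.span C = {0}"
    using exists_finite_complement[OF subspace_range[OF W] B(1)] unfolding B(2) by (elim exE conjE)
  then have span_C: "complex_vector.span (range W \<union> C) = UNIV"
    by (intro subset_antisym subset_UNIV)
  obtain Q :: "'b \<Rightarrow> 'b" where Q: "bounded_clinear Q" "range Q \<subseteq> complex_vector.span C"
    "\<And>y. y \<in> complex_vector.span C \<Longrightarrow> Q y = y"
    using exists_bounded_projection[OF C(1)] by auto
  define \<Psi> where "\<Psi> z = W (fst z) + Q (snd z)" for z
  have \<Psi>: "bounded_clinear \<Psi>"
    unfolding \<Psi>_def
    by (intro bounded_clinear_plus bounded_clinear_compose[OF W bounded_clinear_fst]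
        bounded_clinear_compose[OF Q(1) bounded_clinear_snd])
  have "\<exists>z. y = \<Psi> z" for y
  proof -
    obtain x where "y - W x \<in> complex_vector.span C"
      using span_C[unfolded span_subspace_Un_eq_UNIV[OF subspace_range[OF W]]] by blast
    then show ?thesis
      by (intro exI[of _ "(x, y - W x)"]) (simp add: \<Psi>_def Q(3))
  qed
  then have "surj \<Psi>"
    unfolding surj_def by blast
  then obtain M where M: "\<And>y. \<exists>z. \<Psi> z = y \<and> norm z \<le> M * norm y"
    using open_mapping_bound[OF bounded_clinear_bounded_linear[OF \<Psi>]] by blast
  then obtain h where h: "\<And>y. \<Psi> (h y) = y" "\<And>y. norm (h y) \<le> M * norm y"
    by metis
  define G where "G y = fst (h y) - P (fst (h y))" for y
  have h_span: "y - W (fst (h y)) \<in> complex_vector.span C" for y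
  proof -
    have "y - W (fst (h y)) = Q (snd (h y))"
      using h(1)[of y] by (simp add: \<Psi>_def algebra_simps)
    then show ?thesis
      using Q(2) by auto
  qed
  \<comment> \<open>The choice \<open>h\<close> is norm-controlled but not linear. Linearity of
    \<open>G\<close> follows by testing this identity on sums and multiples of the chosen
    solutions.\<close>
  have G_eq: "G y = x - P x" if "y - W x \<in> complex_vector.span C" for x y
  proof -
    have "(y - W x) - (y - W (fst (h y))) \<in> complex_vector.span C"
      by (rule complex_vector.span_diff[OF that h_span])
    moreover have "(y - W x) - (y - W (fst (h y))) = W (fst (h y) - x)"
      by (simp add: bounded_clinear_diff[OF W])
    ultimately have "W (fst (h y) - x) = 0"
      using C(3) by auto
    then have "P (fst (h y) - x) = fst (h y) - x"
      by (intro P(3)) (simp add: kernel_def)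
    then show ?thesis
      by (simp add: G_def bounded_clinear_diff[OF P(1)] algebra_simps)
  qed
  obtain K where K: "K > 0" "\<And>x. norm (P x) \<le> K * norm x"
    using bounded_clinear_bound[OF P(1)] by blast
  have "bounded_clinear G"
  proof (rule bounded_clinearI[where K = "(1 + K) * M"])
    show "G (x + y) = G x + G y" for x y
    proof -
      have "(x + y) - W (fst (h x) + fst (h y)) \<in> complex_vector.span C"
        using complex_vector.span_add[OF h_span[of x] h_span[of y]]
        by (simp add: bounded_clinear_add[OF W] algebra_simps)
      then show ?thesis
        using G_eq by (simp add: G_def bounded_clinear_add[OF P(1)])
    qed
    show "G (c *\<^sub>C x) = c *\<^sub>C G x" for c x
    proof -
      have "c *\<^sub>C x - W (c *\<^sub>C fst (h x)) \<in> complex_vector.span C"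
        using complex_vector.span_scale[OF h_span[of x], of c]
        by (simp add: bounded_clinear_scaleC[OF W] complex_vector.scale_right_diff_distrib)
      then show ?thesis
        using G_eq by (simp add: G_def bounded_clinear_scaleC[OF P(1)]
            complex_vector.scale_right_diff_distrib)
    qed
    show "norm (G x) \<le> (1 + K) * M * norm x" for x
    proof -
      have "norm (G x) \<le> norm (fst (h x)) + norm (P (fst (h x)))"
        unfolding G_def by (rule norm_triangle_ineq4)
      also have "\<dots> \<le> (1 + K) * norm (fst (h x))"
        using K(2)[of "fst (h x)"] by (simp add: algebra_simps)
      also have "\<dots> \<le> (1 + K) * (M * norm x)"
        using norm_fst_le[of "fst (h x)" "snd (h x)"] h(2)[of x] K(1)
        by (intro mult_left_mono) auto
      finally show ?thesis
        by (simp add: mult.assoc)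
    qed
  qed
  moreover have "G (W x) = x - P x" for x
    by (rule G_eq) (simp add: complex_vector.span_zero)
  moreover have "finite_rank P"
    by (rule finite_rankI[OF P(1) A(1)]) (use P(2) A(2) in auto)
  ultimately show ?thesis
    using that by blast
qed

text \<open>Membership in the class is locally constant in t. A left parametrix \<open>G\<close> at
  \<open>a\<close> satisfies G W_t = I + (a - t) G K - P, and the first two terms are invertible for
  |a - t| < 1/L. Since \<open>G\<close> does not depend on t, it links all W_t in this ball;
  connectedness of the line leads from W_0 = I to W_1.\<close>

lemma weyl_id_minus:
  fixes K :: "'a :: complex_banach \<Rightarrow> 'a"
  assumes K: "bounded_clinear K"
    and fred: "\<And>c. fredholm (\<lambda>x. x - c *\<^sub>C K x)"
  shows "weyl (\<lambda>x. x - K x)"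
proof -
  define W where "W t x = x - complex_of_real t *\<^sub>C K x" for t x
  have W: "bounded_clinear (W t)" for t
    unfolding W_def by (intro bounded_clinear_sub bounded_clinear_id bounded_clinear_scaleC_op K)
  have "weyl (W 1)"
  proof (rule connected_induction_simple[of UNIV 0 1 "\<lambda>t. weyl (W t)"])
    show "weyl (W 0)"
      by (rule weylI[OF invertible_op_id finite_rank_zero]) (simp add: W_def)
  next
    fix a :: real
    obtain G P where G: "bounded_clinear G" and P: "finite_rank P"
      and GW: "\<And>x. G (W a x) = x - P x"
      using fredholm_left_parametrix[of "W a"] fred unfolding W_def by blast
    obtain L where L: "L > 0" "\<And>x. norm (G (K x)) \<le> L * norm x"
      using bounded_clinear_bound[OF bounded_clinear_compose[OF G K]] by blast
    have near: "weyl (\<lambda>x. G (W t x))" if t: "t \<in> ball a (1 / L)" for t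
    proof (rule weylI)
      show "invertible_op (\<lambda>x. x + complex_of_real (a - t) *\<^sub>C G (K x))"
      proof (rule invertible_op_id_plus_contraction[where c = "\<bar>a - t\<bar> * L"])
        show "bounded_clinear (\<lambda>x. complex_of_real (a - t) *\<^sub>C G (K x))"
          by (intro bounded_clinear_scaleC_op bounded_clinear_compose[OF G K])
        show "\<bar>a - t\<bar> * L < 1"
          using t L(1) by (simp add: dist_real_def field_simps)
        show "norm (complex_of_real (a - t) *\<^sub>C G (K x)) \<le> \<bar>a - t\<bar> * L * norm x" for x
          using mult_left_mono[OF L(2)[of x], of "\<bar>a - t\<bar>"]
          by (simp add: norm_scaleC mult.assoc del: of_real_diff)
      qed
      show "finite_rank (\<lambda>x. - P x)"
        by (rule finite_rank_minus[OF P])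
      show "G (W t x) = x + complex_of_real (a - t) *\<^sub>C G (K x) + - P x" for x
      proof -
        have "W t x = W a x + complex_of_real (a - t) *\<^sub>C K x"
          by (simp add: W_def complex_vector.scale_left_diff_distrib)
        then have "G (W t x) = G (W a x) + complex_of_real (a - t) *\<^sub>C G (K x)"
          by (simp only: bounded_clinear_add[OF G] bounded_clinear_scaleC[OF G])
        then show ?thesis
          by (simp add: GW del: of_real_diff)
      qed
    qed
    \<comment> \<open>From \<open>W s\<close> and G W_s the property passes to \<open>G\<close>, and
      from \<open>G\<close> and G W_t on to \<open>W t\<close>.\<close>
    have step: "weyl (W t)" if "s \<in> ball a (1 / L)" "t \<in> ball a (1 / L)" "weyl (W s)" for s t
      using weyl_right_factor[OF weyl_left_factor[OF that(3) G near[OF that(1)]] W near[OF that(2)]] .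
    show "\<exists>T. openin (top_of_set UNIV) T \<and> a \<in> T \<and>
        (\<forall>s\<in>T. \<forall>t\<in>T. weyl (W s) \<longrightarrow> weyl (W t))"
    proof (intro exI[of _ "ball a (1 / L)"] conjI ballI impI)
      show "a \<in> ball a (1 / L)"
        using L(1) by simp
    qed (simp, rule step)
  qed auto
  moreover have "W 1 = (\<lambda>x. x - K x)"
    by (simp add: W_def fun_eq_iff)
  ultimately show ?thesis
    by simp
qed

section \<open>Schur coupling\<close>

lemma weyl_schur_complement:
  fixes A :: "'x :: complex_banach \<Rightarrow> 'x" and D :: "'y :: complex_banach \<Rightarrow> 'y"
  assumes inc: "essentially_incomparable TYPE('x) TYPE('y)"
    and A: "invertible_op A" and B: "bounded_clinear B" and C: "bounded_clinear C"
    and D: "invertible_op D"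
  shows "weyl (\<lambda>x. A x - B (inv D (C x)))"
proof -
  define S where "S x = inv D (C x)" for x
  define T where "T y = inv A (B y)" for y
  have bA: "bounded_clinear A"
    using A by (simp add: invertible_op_def)
  have S: "bounded_clinear S" and T: "bounded_clinear T"
    unfolding S_def T_def
    by (rule bounded_clinear_compose[OF invertible_op_inv(1)[OF D] C],
        rule bounded_clinear_compose[OF invertible_op_inv(1)[OF A] B])
  have "weyl (\<lambda>x. x - T (S x))"
  proof (rule weyl_id_minus[OF bounded_clinear_compose[OF T S]])
    fix c
    \<comment> \<open>The scalar is absorbed into \<open>T\<close>, so incomparability covers every
      point of the path.\<close>
    have "bounded_clinear (\<lambda>y. c *\<^sub>C T y)"
      by (rule bounded_clinear_scaleC_op[OF T])
    then show "fredholm (\<lambda>x. x - c *\<^sub>C T (S x))"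
      using inc S unfolding essentially_incomparable_iff by blast
  qed
  then have "weyl (\<lambda>x. A (x - T (S x)))"
    by (rule weyl_invertible_compose[OF A])
  then show ?thesis
    by (simp add: bounded_clinear_diff[OF bA] T_def S_def invertible_op_inv(3)[OF A])
qed

lemma schur_coupled_id_minus:
  assumes S: "bounded_clinear S" and T: "bounded_clinear T"
  shows "schur_coupled (\<lambda>x. x - T (S x)) (\<lambda>y. y - S (T y))"
proof -
  have inv_id: "inv (\<lambda>x :: 'z. x) = (\<lambda>x. x)"
    by (rule inv_equality) auto
  have "bounded_clinear (block_op (\<lambda>x. x) T S (\<lambda>y. y))"
    unfolding block_op_def case_prod_beta
    by (intro bounded_clinear_Pair bounded_clinear_plus bounded_clinear_fst bounded_clinear_snd
        bounded_clinear_compose[OF S bounded_clinear_fst]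
        bounded_clinear_compose[OF T bounded_clinear_snd])
  then show ?thesis
    unfolding schur_coupled_def
    by (intro exI[of _ "\<lambda>x. x"] exI[of _ T] exI[of _ S])
      (simp add: S T bounded_clinear_id invertible_op_id inv_id)
qed

theorem proposition2p4:
  shows
    "(essentially_incomparable TYPE('x :: complex_banach) TYPE('y :: complex_banach) \<longleftrightarrow>
       (\<forall>(U :: 'x \<Rightarrow> 'x) (V :: 'y \<Rightarrow> 'y).
          bounded_clinear U \<and> bounded_clinear V \<and> schur_coupled U V \<longrightarrow>
          fredholm U \<and> fredholm_index U = 0 \<and> fredholm V \<and> fredholm_index V = 0)) \<and>
     (essentially_incomparable TYPE('x) TYPE('y) \<longleftrightarrow>
       (\<forall>(U :: 'x \<Rightarrow> 'x) (V :: 'y \<Rightarrow> 'y).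
          bounded_clinear U \<and> bounded_clinear V \<and> schur_coupled U V \<longrightarrow>
          fredholm U \<and> fredholm V)) \<and>
     (essentially_incomparable TYPE('x) TYPE('y) \<longleftrightarrow>
       (\<forall>(U :: 'x \<Rightarrow> 'x) (V :: 'y \<Rightarrow> 'y).
          bounded_clinear U \<and> bounded_clinear V \<and>
          equivalent_after_extension TYPE('x \<times> 'y \<times> 'u :: complex_banach) U V \<longrightarrow>
          fredholm U \<and> fredholm V))"
    (is "(?inc \<longleftrightarrow> ?index) \<and> (_ \<longleftrightarrow> ?sc) \<and> (_ \<longleftrightarrow> ?eae)")
proof -
  have 1: ?index if inc: ?inc
  proof (intro allI impI)
    fix U :: "'x \<Rightarrow> 'x" and V :: "'y \<Rightarrow> 'y"
    assume "bounded_clinear U \<and> bounded_clinear V \<and> schur_coupled U V"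
    then obtain A B C D where ops: "bounded_clinear B" "bounded_clinear C"
      "invertible_op A" "invertible_op D"
      and U: "U = (\<lambda>x. A x - B (inv D (C x)))" and V: "V = (\<lambda>y. D y - C (inv A (B y)))"
      unfolding schur_coupled_def by blast
    have "weyl U" "weyl V"
      unfolding U V
      \<comment> \<open>\<open>V\<close> is the same Schur complement with the two spaces exchanged,
        so symmetry of incomparability handles it.\<close>
      using weyl_schur_complement[OF inc ops(3,1,2,4)]
        weyl_schur_complement[OF essentially_incomparable_commute[OF inc] ops(4,2,1,3)]
      by auto
    then show "fredholm U \<and> fredholm_index U = 0 \<and> fredholm V \<and> fredholm_index V = 0"
      by (simp add: weyl_fredholm_index)
  qed
  have bounded: "bounded_clinear (\<lambda>x. x - T (S x))"
    if "bounded_clinear S" "bounded_clinear T"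
    for S :: "'p :: complex_banach \<Rightarrow> 'q :: complex_banach" and T
    by (intro bounded_clinear_sub bounded_clinear_id bounded_clinear_compose[OF that(2,1)])
  have 2: ?inc if sc: ?sc
    unfolding essentially_incomparable_iff
  proof (intro allI impI)
    fix S :: "'x \<Rightarrow> 'y" and T :: "'y \<Rightarrow> 'x"
    assume ST: "bounded_clinear S" "bounded_clinear T"
    show "fredholm (\<lambda>x. x - T (S x))"
      using sc[rule_format, OF conjI[OF bounded[OF ST] conjI[OF bounded[OF ST(2,1)]
            schur_coupled_id_minus[OF ST]]]] by (rule conjunct1)
  qed
  have 3: ?inc if eae: ?eae
    unfolding essentially_incomparable_iff
  proof (intro allI impI)
    fix S :: "'x \<Rightarrow> 'y" and T :: "'y \<Rightarrow> 'x"
    assume ST: "bounded_clinear S" "bounded_clinear T"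
    show "fredholm (\<lambda>x. x - T (S x))"
      using eae[rule_format, OF conjI[OF bounded[OF ST] conjI[OF bounded[OF ST(2,1)]
            equivalent_after_extension_id_minus[OF ST]]]] by (rule conjunct1)
  qed
  have 4: ?eae if inc: ?inc
  proof (intro allI impI, elim conjE)
    fix U :: "'x \<Rightarrow> 'x" and V :: "'y \<Rightarrow> 'y"
    assume "bounded_clinear U" "bounded_clinear V"
      and eae: "equivalent_after_extension TYPE('x \<times> 'y \<times> 'u) U V"
    then show "fredholm U \<and> fredholm V"
      using fredholm_if_equivalent_after_extension[OF inc _ eae]
        fredholm_if_equivalent_after_extension[OF essentially_incomparable_commute[OF inc] _
          equivalent_after_extension_commute[OF eae]]
      by simp
  qed
  have 5: ?sc if index: ?index
  proof (intro allI impI)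
    fix U :: "'x \<Rightarrow> 'x" and V :: "'y \<Rightarrow> 'y"
    assume "bounded_clinear U \<and> bounded_clinear V \<and> schur_coupled U V"
    from index[rule_format, OF this] show "fredholm U \<and> fredholm V"
      by simp
  qed
  show ?thesis
    using 1 2 3 4 5 by argo
qed

end
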